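(* Let $M_1,M_2$ be matroids of positive rank on disjoint ground sets $S_1,S_2$, with rank functions $r_1,r_2$ and nullity functions $\eta_1,\eta_2$. Let $S'_1\subseteq S_1$ and $S'_2\subseteq S_2$, let $k$ be an integer with $k\ge r(M_1)+\eta_1(S'_1)+r(M_2)+\eta_2(S'_2)$, and let $T_1,T_2$ be sets with $|T_1|=k-r(M_1)-|S'_2|$ and $|T_2|=k-r(M_2)-|S'_1|$ such that $T_1$, $T_2$, $S_1\cup S_2$ are pairwise disjoint. Let $E=S_1\cup S_2\cup T_1\cup T_2$. Let $\mathcal{Z}$ consist of $\emptyset$, $E$, the sets $F\cup T_1\cup S'_2$ for $F\in\mathcal{Z}'(M_1)$, and the sets $F\cup T_2\cup S'_1$ for $F\in\mathcal{Z}'(M_2)$, and define $r$ on $\mathcal{Z}$ by $r(\emptyset)=0$, $r(E)=k$, $r(F\cup T_1\cup S'_2)=r_1(F)+|T_1|+|S'_2|$ for $F\in\mathcal{Z}'(M_1)$, and $r(F\cup T_2\cup S'_1)=r_2(F)+|T_2|+|S'_1|$ for $F\in\mathcal{Z}'(M_2)$. Then there is a matroid $M$ on $E$ whose collection of cyclic flats is exactly $\mathcal{Z}$ and whose rank function agrees with $r$ on $\mathcal{Z}$ (equivalently, $(\mathcal{Z},r)$ satisfies: $\mathcal{Z}$ is a lattice under inclusion; $r$ of its least element is $0$; $0<r(Y)-r(X)<|Y-X|$ for $X\subset Y$ in $\mathcal{Z}$; and $r(X)+r(Y)\ge r(X\vee Y)+r(X\wedge Y)+|(X\cap Y)-(X\wedge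 Y)|$ for incomparable $X,Y\in\mathcal{Z}$). This matroid has rank $k$ and satisfies: (i) $M|(S_1\cup T_1\cup S'_2)=M_1\times(T_1\cup S'_2)$ and $M|(S_2\cup T_2\cup S'_1)=M_2\times(T_2\cup S'_1)$, i.e. $M$ is an amalgam of $M_1\times(T_1\cup S'_2)$ and $M_2\times(T_2\cup S'_1)$; and (ii) $\eta_1(F)=\eta_M(F\cup T_1\cup S'_2)$ for all $F\in\mathcal{Z}'(M_1)$ and $\eta_2(F)=\eta_M(F\cup T_2\cup S'_1)$ for all $F\in\mathcal{Z}'(M_2)$.
   Context: All matroids are finite. A cyclic set is a (possibly empty) union of circuits; a cyclic flat is a flat that is a cyclic set. For a matroid $N$, $\mathcal{Z}(N)$ is its set of cyclic flats and $\mathcal{Z}'(N)$ its set of nonempty proper cyclic flats; the nullity of $Y$ is $\eta_N(Y)=|Y|-r_N(Y)$. The free extension $N+x$ of $N$ by a new element $x$ is the matroid whose circuits are the circuits of $N$ together with the sets $B\cup x$ for bases $B$ of $N$; $N+X$ is obtained by freely adding the elements of $X$ one at a time. The free coextension is $N\times X=(N^*+X)^*$. A matroid $M$ on $S_1\cup S_2$ with $M|S_1=N_1$ and $M|S_2=N_2$ is an amalgam of $N_1$ and $N_2$.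
   Formalization: The formal theorem adds two conditions, without which the claim fails since E is then not cyclic: if T_2 is empty and S'_2=S_2, then M_1 has no coloops; and if T_1 is empty and S'_1=S_1, then M_2 has no coloops. *)

theory Defs
  imports "HOL-Algebra.Lattice"
begin

section \<open>Matroids\<close>

record 'a indep_system =
  ground :: "'a set"
  indep :: "'a set set"

locale matroid =
  fixes M :: "'a indep_system" (structure)
  assumes finite_ground: "finite (ground M)"
    and indep_subset: "I \<in> indep M \<Longrightarrow> I \<subseteq> ground M"
    and indep_empty: "{} \<in> indep M"
    and indep_mono: "\<lbrakk>I \<in> indep M; J \<subseteq> I\<rbrakk> \<Longrightarrow> J \<in> indep M"
    and augmentation: "\<lbrakk>I \<in> indep M; J \<in> indep M; card I < card J\<rbrakk>
      \<Longrightarrow> \<exists>x \<in> J - I. insert x I \<in> indep M"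

definition basis :: "'a indep_system \<Rightarrow> 'a set \<Rightarrow> bool" where
  "basis M B \<longleftrightarrow> B \<in> indep M \<and> (\<forall>I \<in> indep M. B \<subseteq> I \<longrightarrow> I = B)"

definition rank :: "'a indep_system \<Rightarrow> 'a set \<Rightarrow> nat" where
  "rank M A = Max (card ` {I \<in> indep M. I \<subseteq> A})"

definition nullity :: "'a indep_system \<Rightarrow> 'a set \<Rightarrow> int" where
  "nullity M A = int (card A) - int (rank M A)"

definition circuits :: "'a indep_system \<Rightarrow> 'a set set" where
  "circuits M = {C. C \<subseteq> ground M \<and> C \<notin> indep M \<and> (\<forall>D. D \<subset> C \<longrightarrow> D \<in> indep M)}"

definition coloop :: "'a indep_system \<Rightarrow> 'a \<Rightarrow> bool" where
  "coloop M e \<longleftrightarrow> e \<in> ground M \<and> (\<forall>B. basis M B \<longrightarrow> e \<in> B)"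

definition flat :: "'a indep_system \<Rightarrow> 'a set \<Rightarrow> bool" where
  "flat M F \<longleftrightarrow> F \<subseteq> ground M \<and> (\<forall>x \<in> ground M - F. rank M F < rank M (insert x F))"

definition cyclic :: "'a indep_system \<Rightarrow> 'a set \<Rightarrow> bool" where
  "cyclic M A \<longleftrightarrow> (\<exists>\<C> \<subseteq> circuits M. A = \<Union>\<C>)"

definition cyclic_flats :: "'a indep_system \<Rightarrow> 'a set set" where
  "cyclic_flats M = {F. flat M F \<and> cyclic M F}"

definition proper_cyclic_flats :: "'a indep_system \<Rightarrow> 'a set set" where
  "proper_cyclic_flats M = {F \<in> cyclic_flats M. F \<noteq> {} \<and> F \<noteq> ground M}"

section \<open>Restriction, duality, free extension and coextension, amalgams\<close>

definition restriction :: "'a indep_system \<Rightarrow> 'a set \<Rightarrow> 'a indep_system" where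
  "restriction M A = \<lparr>ground = A, indep = {I \<in> indep M. I \<subseteq> A}\<rparr>"

definition dual :: "'a indep_system \<Rightarrow> 'a indep_system" where
  "dual M = \<lparr>ground = ground M,
             indep = {I. \<exists>B. basis M B \<and> I \<subseteq> ground M - B}\<rparr>"

definition from_circuits :: "'a set \<Rightarrow> 'a set set \<Rightarrow> 'a indep_system" where
  "from_circuits E \<C> = \<lparr>ground = E, indep = {I. I \<subseteq> E \<and> \<not> (\<exists>C \<in> \<C>. C \<subseteq> I)}\<rparr>"

text \<open>Meaningful only for \<open>x \<notin> ground N\<close>.\<close>

definition free_ext :: "'a indep_system \<Rightarrow> 'a \<Rightarrow> 'a indep_system" where
  "free_ext N x =
     from_circuits (insert x (ground N)) (circuits N \<union> {insert x B | B. basis N B})"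

text \<open>The elements of a finite set \<open>X\<close> are added freely one at a time, along some enumeration
  of \<open>X\<close>. For \<open>X\<close> disjoint from \<open>ground N\<close> the result does not depend on the enumeration.\<close>

definition free_extension :: "'a indep_system \<Rightarrow> 'a set \<Rightarrow> 'a indep_system" where
  "free_extension N X = foldl free_ext N (SOME xs. distinct xs \<and> set xs = X)"

definition free_coextension :: "'a indep_system \<Rightarrow> 'a set \<Rightarrow> 'a indep_system" where
  "free_coextension N X = dual (free_extension (dual N) X)"

definition amalgam :: "'a indep_system \<Rightarrow> 'a indep_system \<Rightarrow> 'a indep_system \<Rightarrow> bool" where
  "amalgam M N\<^sub>1 N\<^sub>2 \<longleftrightarrow> matroid M \<and> ground M = ground N\<^sub>1 \<union> ground N\<^sub>2
     \<and> restriction M (ground N\<^sub>1) = N\<^sub>1 \<and> restriction M (ground N\<^sub>2) = N\<^sub>2"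

section \<open>The axiom scheme for cyclic flats and their ranks\<close>

abbreviation inclusion_order :: "'a set set \<Rightarrow> 'a set gorder" where
  "inclusion_order \<Z> \<equiv> \<lparr>carrier = \<Z>, eq = (=), le = (\<subseteq>)\<rparr>"

definition cyclic_flat_axioms :: "'a set set \<Rightarrow> ('a set \<Rightarrow> int) \<Rightarrow> bool" where
  "cyclic_flat_axioms \<Z> r \<longleftrightarrow>
     (let L = inclusion_order \<Z> in
       Lattice.lattice L \<and>
       (\<exists>Z\<^sub>0. least L Z\<^sub>0 \<Z> \<and> r Z\<^sub>0 = 0) \<and>
       (\<forall>X \<in> \<Z>. \<forall>Y \<in> \<Z>. X \<subset> Y \<longrightarrow> 0 < r Y - r X \<and> r Y - r X < int (card (Y - X))) \<and>
       (\<forall>X \<in> \<Z>. \<forall>Y \<in> \<Z>. \<not> X \<subseteq> Y \<and> \<not> Y \<subseteq> X \<longrightarrow>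
          r X + r Y \<ge> r (X \<squnion>\<^bsub>L\<^esub> Y) + r (X \<sqinter>\<^bsub>L\<^esub> Y) + int (card ((X \<inter> Y) - (X \<sqinter>\<^bsub>L\<^esub> Y)))))"

section \<open>Sanity checks\<close>

text \<open>The prescribed family really is the set of circuits of the free extension.\<close>

lemma (in matroid) dependent_contains_circuit:
  assumes "A \<subseteq> ground M" "A \<notin> indep M"
  shows "\<exists>C \<in> circuits M. C \<subseteq> A"
proof -
  have "finite A" using assms(1) finite_ground finite_subset by blast
  then show ?thesis using assms
  proof (induction A rule: finite_psubset_induct)
    case (psubset A)
    show ?case
    proof (cases "\<forall>D. D \<subset> A \<longrightarrow> D \<in> indep M")
      case True
      then show ?thesis using psubset.prems by (auto simp: circuits_def)
    next
      case False
      then obtain D where D: "D \<subset> A" "D \<notin> indep M" by blast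
      then have "\<exists>C \<in> circuits M. C \<subseteq> D"
        using psubset.IH[of D] psubset.prems(1) by simp
      then show ?thesis using D(1) by blast
    qed
  qed
qed

lemma (in matroid) circuits_free_ext:
  assumes x: "x \<notin> ground M"
  shows "circuits (free_ext M x) = circuits M \<union> {insert x B | B. basis M B}"
proof -
  let ?\<C> = "circuits M \<union> {insert x B | B. basis M B}"
  have sub: "C \<subseteq> insert x (ground M)" if "C \<in> ?\<C>" for C
    using that indep_subset by (auto simp: circuits_def basis_def)
  have clutter: "C = D" if "C \<in> ?\<C>" "D \<in> ?\<C>" "C \<subseteq> D" for C D
  proof -
    have "C \<in> circuits M \<or> (\<exists>B. C = insert x B \<and> basis M B)"
      "D \<in> circuits M \<or> (\<exists>B. D = insert x B \<and> basis M B)"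
      using that(1,2) by auto
    then consider (cc) "C \<in> circuits M" "D \<in> circuits M"
      | (cb) B where "C \<in> circuits M" "D = insert x B" "basis M B"
      | (bc) B where "C = insert x B" "basis M B" "D \<in> circuits M"
      | (bb) B B' where "C = insert x B" "basis M B" "D = insert x B'" "basis M B'"
      by metis
    then show ?thesis
    proof cases
      case cc
      then show ?thesis using that(3) by (auto simp: circuits_def)
    next
      case cb
      then have "C \<subseteq> B" using x that(3) by (auto simp: circuits_def)
      then show ?thesis using cb indep_mono by (auto simp: circuits_def basis_def)
    next
      case bc
      then show ?thesis using x that(3) by (auto simp: circuits_def)
    next
      case bb
      then have "x \<notin> B" using x indep_subset by (auto simp: basis_def)
      then have "B \<subseteq> B'" using bb that(3) by blast
      then show ?thesis using bb by (auto simp: basis_def)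
    qed
  qed
  have "C \<in> circuits (free_ext M x) \<longleftrightarrow> C \<in> ?\<C>" for C
  proof
    assume C: "C \<in> circuits (free_ext M x)"
    then have "C \<subseteq> insert x (ground M)" "C \<notin> indep (free_ext M x)"
      by (simp_all add: circuits_def free_ext_def from_circuits_def)
    then obtain D where D: "D \<in> ?\<C>" "D \<subseteq> C"
      unfolding free_ext_def from_circuits_def by auto
    have "\<not> D \<subset> C"
    proof
      assume "D \<subset> C"
      then have "D \<in> indep (free_ext M x)" using C by (simp add: circuits_def)
      then show False using D(1) by (auto simp: free_ext_def from_circuits_def)
    qed
    then show "C \<in> ?\<C>" using D by blast
  next
    assume C: "C \<in> ?\<C>"
    have "D \<in> indep (free_ext M x)" if "D \<subset> C" for D
    proof -
      have "\<not> C' \<subseteq> D" if "C' \<in> ?\<C>" for C'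
        using clutter[OF that C] \<open>D \<subset> C\<close> by blast
      then show ?thesis using sub[OF C] \<open>D \<subset> C\<close>
        unfolding free_ext_def from_circuits_def by auto
    qed
    then show "C \<in> circuits (free_ext M x)"
      using C sub[OF C] unfolding circuits_def[of "free_ext M x"]
      by (auto simp: free_ext_def from_circuits_def)
  qed
  then show ?thesis by blast
qed

lemma (in matroid) finite_indep_subsets: "finite {I \<in> indep M. I \<subseteq> A}"
  by (rule finite_subset[of _ "Pow (ground M)"])
    (use indep_subset in blast, simp add: finite_ground)

lemma (in matroid) rank_mono: "A \<subseteq> B \<Longrightarrow> rank M A \<le> rank M B"
  unfolding rank_def
  by (rule Max_mono) (use finite_indep_subsets indep_empty in auto)

lemma (in matroid) rank_le_card:
  assumes "finite A" shows "rank M A \<le> card A"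
proof -
  have "card ` {I \<in> indep M. I \<subseteq> A} \<noteq> {}" using indep_empty by blast
  then show ?thesis unfolding rank_def
    using assms finite_indep_subsets by (auto simp: card_mono)
qed

lemma (in matroid) proper_flat_rank:
  assumes "F \<in> proper_cyclic_flats M"
  shows "F \<subset> ground M" "rank M F < rank M (ground M)"
proof -
  show F: "F \<subset> ground M"
    using assms by (auto simp: proper_cyclic_flats_def cyclic_flats_def flat_def)
  then obtain x where x: "x \<in> ground M - F" by blast
  then have "rank M F < rank M (insert x F)"
    using assms by (auto simp: proper_cyclic_flats_def cyclic_flats_def flat_def)
  also have "\<dots> \<le> rank M (ground M)" using F x by (intro rank_mono) blast
  finally show "rank M F < rank M (ground M)" .
qed

text \<open>The case distinction that defines the prescribed rank function is unambiguous: the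
  sets of the four kinds are pairwise distinct.\<close>

lemma prescribed_rank_well_defined:
  fixes k :: int
  assumes "matroid M\<^sub>1" "matroid M\<^sub>2"
    and "ground M\<^sub>1 = S\<^sub>1" "ground M\<^sub>2 = S\<^sub>2" "S\<^sub>1 \<inter> S\<^sub>2 = {}"
    and sub: "S\<^sub>1' \<subseteq> S\<^sub>1" "S\<^sub>2' \<subseteq> S\<^sub>2"
    and k: "k \<ge> int (rank M\<^sub>1 S\<^sub>1) + nullity M\<^sub>1 S\<^sub>1' + int (rank M\<^sub>2 S\<^sub>2) + nullity M\<^sub>2 S\<^sub>2'"
    and fin: "finite T\<^sub>1" "finite T\<^sub>2"
    and T: "int (card T\<^sub>1) = k - int (rank M\<^sub>1 S\<^sub>1) - int (card S\<^sub>2')"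
      "int (card T\<^sub>2) = k - int (rank M\<^sub>2 S\<^sub>2) - int (card S\<^sub>1')"
    and disj: "T\<^sub>1 \<inter> T\<^sub>2 = {}" "T\<^sub>1 \<inter> (S\<^sub>1 \<union> S\<^sub>2) = {}" "T\<^sub>2 \<inter> (S\<^sub>1 \<union> S\<^sub>2) = {}"
    and E: "E = S\<^sub>1 \<union> S\<^sub>2 \<union> T\<^sub>1 \<union> T\<^sub>2"
  shows "\<exists>r :: 'a set \<Rightarrow> int. r {} = 0 \<and> r E = k
    \<and> (\<forall>F \<in> proper_cyclic_flats M\<^sub>1. r (F \<union> T\<^sub>1 \<union> S\<^sub>2') =
         int (rank M\<^sub>1 F) + int (card T\<^sub>1) + int (card S\<^sub>2'))
    \<and> (\<forall>F \<in> proper_cyclic_flats M\<^sub>2. r (F \<union> T\<^sub>2 \<union> S\<^sub>1') =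
         int (rank M\<^sub>2 F) + int (card T\<^sub>2) + int (card S\<^sub>1'))"
proof -
  interpret M1: matroid M\<^sub>1 by fact
  interpret M2: matroid M\<^sub>2 by fact
  have finS: "finite S\<^sub>1" "finite S\<^sub>2" using assms M1.finite_ground M2.finite_ground by auto
  have n: "nullity M\<^sub>1 S\<^sub>1' \<ge> 0" "nullity M\<^sub>2 S\<^sub>2' \<ge> 0"
    using M1.rank_le_card[of S\<^sub>1'] M2.rank_le_card[of S\<^sub>2'] sub finS
    by (auto simp: nullity_def finite_subset)
  have P1: "F \<noteq> {}" "F \<subseteq> S\<^sub>1" "F \<noteq> S\<^sub>1" "rank M\<^sub>1 F < rank M\<^sub>1 S\<^sub>1"
    if "F \<in> proper_cyclic_flats M\<^sub>1" for F
    using M1.proper_flat_rank[OF that] that assms(3) by (auto simp: proper_cyclic_flats_def)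
  have P2: "F \<noteq> {}" "F \<subseteq> S\<^sub>2" "F \<noteq> S\<^sub>2" "rank M\<^sub>2 F < rank M\<^sub>2 S\<^sub>2"
    if "F \<in> proper_cyclic_flats M\<^sub>2" for F
    using M2.proper_flat_rank[OF that] that assms(4) by (auto simp: proper_cyclic_flats_def)
  have r1: "F = (F \<union> T\<^sub>1 \<union> S\<^sub>2') \<inter> S\<^sub>1" if "F \<in> proper_cyclic_flats M\<^sub>1" for F
    using P1[OF that] disj assms(5) sub by blast
  have r2: "F = (F \<union> T\<^sub>2 \<union> S\<^sub>1') \<inter> S\<^sub>2" if "F \<in> proper_cyclic_flats M\<^sub>2" for F
    using P2[OF that] disj assms(5) sub by blast
  have cross: False if F: "F \<in> proper_cyclic_flats M\<^sub>1" and G: "G \<in> proper_cyclic_flats M\<^sub>2"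
    and eq: "F \<union> T\<^sub>1 \<union> S\<^sub>2' = G \<union> T\<^sub>2 \<union> S\<^sub>1'" for F G
  proof -
    have "T\<^sub>2 = {}" "F = S\<^sub>1'"
      using eq P1(2)[OF F] P2(2)[OF G] sub disj assms(5) by blast+
    then show False using T k n P1(4)[OF F] by (simp add: nullity_def)
  qed
  have top1: "F \<union> T\<^sub>1 \<union> S\<^sub>2' \<noteq> E" if "F \<in> proper_cyclic_flats M\<^sub>1" for F
    using r1[OF that] P1[OF that] E by blast
  have top2: "F \<union> T\<^sub>2 \<union> S\<^sub>1' \<noteq> E" if "F \<in> proper_cyclic_flats M\<^sub>2" for F
    using r2[OF that] P2[OF that] E by blast
  have k0: "k = 0" if "E = {}"
  proof -
    have "T\<^sub>1 = {}" "S\<^sub>2' = {}" "S\<^sub>1 = {}" using that E sub by auto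
    moreover from this have "rank M\<^sub>1 S\<^sub>1 = 0" using M1.rank_le_card[of "{}"] by simp
    ultimately show ?thesis using T by simp
  qed
  define r where "r Y = (if Y = {} then 0 else if Y = E then k
      else if \<exists>F \<in> proper_cyclic_flats M\<^sub>1. Y = F \<union> T\<^sub>1 \<union> S\<^sub>2'
        then int (rank M\<^sub>1 (Y \<inter> S\<^sub>1)) + int (card T\<^sub>1) + int (card S\<^sub>2')
      else int (rank M\<^sub>2 (Y \<inter> S\<^sub>2)) + int (card T\<^sub>2) + int (card S\<^sub>1'))" for Y
  have "r {} = 0" "r E = k" using k0 by (auto simp: r_def)
  moreover have "r (F \<union> T\<^sub>1 \<union> S\<^sub>2') = int (rank M\<^sub>1 F) + int (card T\<^sub>1) + int (card S\<^sub>2')"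
    if F: "F \<in> proper_cyclic_flats M\<^sub>1" for F
    using P1(1)[OF F] top1[OF F] r1[OF F] F unfolding r_def by auto
  moreover have "r (F \<union> T\<^sub>2 \<union> S\<^sub>1') = int (rank M\<^sub>2 F) + int (card T\<^sub>2) + int (card S\<^sub>1')"
    if F: "F \<in> proper_cyclic_flats M\<^sub>2" for F
  proof -
    have "\<not> (\<exists>G \<in> proper_cyclic_flats M\<^sub>1. F \<union> T\<^sub>2 \<union> S\<^sub>1' = G \<union> T\<^sub>1 \<union> S\<^sub>2')"
      using cross[OF _ F] by metis
    moreover have "F \<union> T\<^sub>2 \<union> S\<^sub>1' \<noteq> {}" using P2(1)[OF F] by blast
    ultimately show ?thesis using top2[OF F] r2[OF F] unfolding r_def by metis
  qed
  ultimately show ?thesis by blast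
qed

end

theory Submission
  imports Defs
begin

text \<open>
  If a family \<open>\<Z>\<close> with ranks \<open>r\<close> satisfies the cyclic flat axioms, then
  \<open>\<rho>(A) = min\<^sub>Z (r(Z) + |A - Z|)\<close> is a matroid rank function. The join-meet inequality gives
  submodularity, and \<open>r(X) < r(W) + |X - W|\<close> for \<open>W \<noteq> X\<close> in \<open>\<Z>\<close> makes the members of
  \<open>\<Z>\<close> exactly the cyclic flats. Conversely, a set is independent in a matroid iff it meets each
  cyclic flat \<open>W\<close> in at most \<open>r(W)\<close> elements.

  For the prescribed family, the lower bound on \<open>k\<close> implies that cyclic flats coming from
  different matroids are never comparable, and it gives the inequality for such a pair, whose join is
  \<open>E\<close> and whose meet is \<open>{}\<close>. The constraints on \<open>I \<subseteq> S\<^sub>1 \<union> X\<close>, where \<open>X = T\<^sub>1 \<union> S\<^sub>2'\<close>, that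
  come from \<open>M\<^sub>2\<close> are void, and the others say \<open>\<eta>\<^sub>1(I \<inter> S\<^sub>1) \<le> |X - I|\<close>, which is independence in
  the free coextension of \<open>M\<^sub>1\<close> by \<open>X\<close>.
\<close>

section \<open>Rank and cyclic sets\<close>

text \<open>The sizes of \<open>T\<^sub>1\<close> and \<open>T\<^sub>2\<close> are chosen so that
  \<open>X\<^sub>1\<close> = \<open>T\<^sub>1 \<union> S\<^sub>2'\<close> has k - r(M_1) elements.
  Then r(F \<union> X_1) = r_1(F) + |X_1| and k = r_1(S_1) + |X_1|, so \<open>E\<close> receives the
  rank that the same formula would give to the lift of S_1: lifting shifts the ranks of M_1 by a
  constant, and two lifts from the same matroid inherit their inequalities from it, except at the
  two ends. At the bottom, {} stands in for X_1, the lift of the empty flat; the missing |X_1| comes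
  back in the cardinality term of the join-meet inequality. At the top, \<open>E\<close> contains
  the lift of S_1 and usually more, which makes the upper bounds on the rank gaps below
  \<open>E\<close> strict. When nothing more is there, that is, when \<open>T\<^sub>2\<close> is
  empty and \<open>S\<^sub>2' = S\<^sub>2\<close>, strictness has to come from M_1 itself; this is
  where the absence of coloops enters.\<close>

context matroid
begin

lemma indep_finite: "I \<in> indep M \<Longrightarrow> finite I"
  using indep_subset finite_ground finite_subset by blast

lemma indep_card_le_rank: "I \<in> indep M \<Longrightarrow> I \<subseteq> A \<Longrightarrow> card I \<le> rank M A"
  unfolding rank_def using finite_indep_subsets by (auto intro!: Max_ge)

lemma rank_attained: obtains I where "I \<in> indep M" "I \<subseteq> A" "card I = rank M A"
proof -
  have "rank M A \<in> card ` {I \<in> indep M. I \<subseteq> A}"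
    unfolding rank_def by (rule Max_in) (use finite_indep_subsets indep_empty in auto)
  then show thesis using that by auto
qed

lemma indep_extend:
  assumes "I \<in> indep M" "I \<subseteq> A"
  obtains J where "J \<in> indep M" "I \<subseteq> J" "J \<subseteq> A" "card J = rank M A"
proof -
  have "\<exists>J \<in> indep M. I \<subseteq> J \<and> J \<subseteq> A \<and> card J = rank M A"
    using assms
  proof (induction "rank M A - card I" arbitrary: I rule: less_induct)
    case less
    show ?case
    proof (cases "card I = rank M A")
      case True
      then show ?thesis using less.prems by blast
    next
      case False
      then have lt: "card I < rank M A" using indep_card_le_rank[OF less.prems] by simp
      obtain K where K: "K \<in> indep M" "K \<subseteq> A" "card K = rank M A" by (rule rank_attained)
      then obtain x where x: "x \<in> K - I" "insert x I \<in> indep M"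
        using augmentation[OF less.prems(1) K(1)] lt by auto
      have "card (insert x I) = Suc (card I)" using x(1) indep_finite[OF less.prems(1)] by simp
      then have "rank M A - card (insert x I) < rank M A - card I" using lt by simp
      moreover have "insert x I \<subseteq> A" using x(1) K(2) less.prems(2) by blast
      ultimately show ?thesis using less.hyps[of "insert x I"] x(2) by blast
    qed
  qed
  then show thesis using that by blast
qed

lemma rank_indep: "I \<in> indep M \<Longrightarrow> rank M I = card I"
  by (simp add: eq_iff indep_card_le_rank rank_le_card indep_finite)

lemma indep_iff_rank: "A \<subseteq> ground M \<Longrightarrow> A \<in> indep M \<longleftrightarrow> rank M A = card A"
proof
  assume A: "A \<subseteq> ground M" and r: "rank M A = card A"
  obtain I where I: "I \<in> indep M" "I \<subseteq> A" "card I = rank M A" by (rule rank_attained)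
  have "finite A" using A finite_ground finite_subset by blast
  then have "I = A" using I r by (simp add: card_subset_eq)
  then show "A \<in> indep M" using I by simp
qed (rule rank_indep)

lemma rank_submodular: "rank M (A \<union> B) + rank M (A \<inter> B) \<le> rank M A + rank M B"
proof -
  obtain I where I: "I \<in> indep M" "I \<subseteq> A \<inter> B" "card I = rank M (A \<inter> B)"
    by (rule rank_attained)
  then obtain K where K: "K \<in> indep M" "I \<subseteq> K" "K \<subseteq> A \<union> B" "card K = rank M (A \<union> B)"
    using indep_extend[of I "A \<union> B"] by blast
  have fin: "finite K" using K(1) by (rule indep_finite)
  have "card (K \<inter> A) \<le> rank M A" "card (K \<inter> B) \<le> rank M B"
    by (rule indep_card_le_rank; use indep_mono[OF K(1)] in blast)+
  moreover have "card (K \<inter> A) + card (K \<inter> B) = card K + card (K \<inter> A \<inter> B)"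
  proof -
    have "(K \<inter> A) \<union> (K \<inter> B) = K" "(K \<inter> A) \<inter> (K \<inter> B) = K \<inter> A \<inter> B" using K(3) by auto
    then show ?thesis using card_Un_Int[of "K \<inter> A" "K \<inter> B"] fin by simp
  qed
  moreover have "card I \<le> card (K \<inter> A \<inter> B)" using I(2) K(2) fin by (intro card_mono) auto
  ultimately show ?thesis using I(3) K(4) by linarith
qed

lemma rank_insert_le: "rank M (insert x A) \<le> Suc (rank M A)"
  using rank_submodular[of A "{x}"] rank_le_card[of "{x}"] by simp

lemma rank_Un_le_card: "finite B \<Longrightarrow> rank M (A \<union> B) \<le> rank M A + card B"
  using rank_submodular[of A B] rank_le_card[of B] by linarith

lemma rank_le_diff: "finite A \<Longrightarrow> rank M A \<le> rank M W + card (A - W)"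
  using rank_mono[of A "W \<union> (A - W)"] rank_Un_le_card[of "A - W" W] by auto

lemma rank_empty: "rank M {} = 0"
  using rank_le_card[of "{}"] by simp

text \<open>A maximum independent subset of \<open>A\<close> grown from \<open>C - {x}\<close>
  cannot pick up \<open>x\<close>, since it would then contain \<open>C\<close>; so it already lies
  in \<open>A - {x}\<close>.\<close>

lemma rank_Diff_circuit:
  assumes C: "C \<in> circuits M" "C \<subseteq> A" "x \<in> C"
  shows "rank M (A - {x}) = rank M A"
proof -
  have "C - {x} \<in> indep M" using C by (auto simp: circuits_def)
  then obtain K where K: "K \<in> indep M" "C - {x} \<subseteq> K" "K \<subseteq> A" "card K = rank M A"
    using indep_extend[of "C - {x}" A] C(2) by blast
  have "x \<notin> K"
  proof
    assume "x \<in> K"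
    then have "C \<subseteq> K" using K(2) by blast
    then show False using indep_mono[OF K(1)] C(1) by (auto simp: circuits_def)
  qed
  then have "rank M A \<le> rank M (A - {x})"
    using indep_card_le_rank[OF K(1), of "A - {x}"] K by auto
  then show ?thesis using rank_mono[of "A - {x}" A] by auto
qed

text \<open>Adding \<open>x\<close> to a maximum independent subset of \<open>A - {x}\<close> must
  produce a dependent set, and every circuit in that set uses \<open>x\<close>.\<close>

lemma circuit_through:
  assumes A: "A \<subseteq> ground M" "x \<in> A" "rank M (A - {x}) = rank M A"
  obtains C where "C \<in> circuits M" "C \<subseteq> A" "x \<in> C"
proof -
  obtain I where I: "I \<in> indep M" "I \<subseteq> A - {x}" "card I = rank M (A - {x})"
    by (rule rank_attained)
  have "insert x I \<notin> indep M"
  proof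
    assume "insert x I \<in> indep M"
    then have "card (insert x I) \<le> rank M A" using I A by (intro indep_card_le_rank) auto
    moreover have "x \<notin> I" using I(2) by blast
    then have "card (insert x I) = Suc (card I)" using indep_finite[OF I(1)] by simp
    ultimately show False using I A by simp
  qed
  moreover have "insert x I \<subseteq> ground M" using I A by blast
  ultimately obtain C where C: "C \<in> circuits M" "C \<subseteq> insert x I"
    using dependent_contains_circuit by blast
  have "x \<in> C"
  proof (rule ccontr)
    assume "x \<notin> C"
    then have "C \<subseteq> I" using C(2) by blast
    then show False using indep_mono[OF I(1)] C(1) by (auto simp: circuits_def)
  qed
  moreover have "C \<subseteq> A" using C(2) I(2) A(2) by blast
  ultimately show thesis using that C(1) by blast
qed

text \<open>The right-hand side says that the restriction to \<open>A\<close> has no coloop. In this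
  form cyclicity can be tested by ranks alone, which is what both the closure argument and the
  reconstruction of cyclic flats need.\<close>

lemma cyclic_iff_rank:
  "cyclic M A \<longleftrightarrow> A \<subseteq> ground M \<and> (\<forall>x \<in> A. rank M (A - {x}) = rank M A)"
proof
  assume "cyclic M A"
  then obtain \<C> where C: "\<C> \<subseteq> circuits M" "A = \<Union>\<C>" by (auto simp: cyclic_def)
  then have "A \<subseteq> ground M" by (auto simp: circuits_def)
  moreover have "rank M (A - {x}) = rank M A" if x: "x \<in> A" for x
  proof -
    obtain D where "D \<in> \<C>" "x \<in> D" using x C(2) by blast
    then show ?thesis using C by (intro rank_Diff_circuit[of D]) auto
  qed
  ultimately show "A \<subseteq> ground M \<and> (\<forall>x \<in> A. rank M (A - {x}) = rank M A)" by blast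
next
  assume A: "A \<subseteq> ground M \<and> (\<forall>x \<in> A. rank M (A - {x}) = rank M A)"
  have "x \<in> \<Union>{C \<in> circuits M. C \<subseteq> A}" if x: "x \<in> A" for x
  proof -
    obtain C where "C \<in> circuits M" "C \<subseteq> A" "x \<in> C"
      by (rule circuit_through[of A x]) (use A x in auto)
    then show ?thesis by blast
  qed
  then have "A = \<Union>{C \<in> circuits M. C \<subseteq> A}" by blast
  then show "cyclic M A"
    unfolding cyclic_def by (intro exI[of _ "{C \<in> circuits M. C \<subseteq> A}"]) auto
qed

lemma cyclic_subset: "cyclic M A \<Longrightarrow> A \<subseteq> ground M"
  by (simp add: cyclic_iff_rank)

lemma cyclic_nullity_pos:
  assumes "cyclic M A" "A \<noteq> {}"
  shows "rank M A < card A"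
proof -
  have A: "A \<subseteq> ground M" "\<forall>x \<in> A. rank M (A - {x}) = rank M A"
    using assms(1) cyclic_iff_rank by auto
  then have "finite A" using finite_ground finite_subset by blast
  obtain x where "x \<in> A" using assms(2) by blast
  then have "rank M A \<le> card (A - {x})" using A rank_le_card[of "A - {x}"] \<open>finite A\<close> by auto
  then show ?thesis using \<open>x \<in> A\<close> \<open>finite A\<close> by (metis card_Diff1_less order_le_less_trans)
qed

lemma cyclic_Un: "cyclic M A \<Longrightarrow> cyclic M B \<Longrightarrow> cyclic M (A \<union> B)"
  unfolding cyclic_def by (metis Un_least Union_Un_distrib)

lemma flat_rank_less: "flat M F \<Longrightarrow> F \<subset> A \<Longrightarrow> A \<subseteq> ground M \<Longrightarrow> rank M F < rank M A"
proof -
  assume F: "flat M F" and A: "F \<subset> A" "A \<subseteq> ground M"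
  then obtain x where "x \<in> A - F" by blast
  then have "rank M F < rank M (insert x F)" using F A by (auto simp: flat_def)
  also have "\<dots> \<le> rank M A" using A \<open>x \<in> A - F\<close> by (intro rank_mono) auto
  finally show ?thesis .
qed

section \<open>The lattice of cyclic flats\<close>

text \<open>\<open>F\<close> is the closure of \<open>A\<close>, found as a maximal superset of the
  same rank. It lies in every flat above \<open>A\<close> by submodularity, and it inherits
  cyclicity because deleting one point of \<open>F\<close> still leaves at least the rank of
  \<open>A\<close> minus that point.\<close>

lemma ex_closure:
  assumes A: "A \<subseteq> ground M"
  shows "\<exists>F. flat M F \<and> A \<subseteq> F \<and> rank M F = rank M A \<and> (cyclic M A \<longrightarrow> cyclic M F)
    \<and> (\<forall>H. flat M H \<and> A \<subseteq> H \<longrightarrow> F \<subseteq> H)"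
proof -
  let ?P = "{F. A \<subseteq> F \<and> F \<subseteq> ground M \<and> rank M F = rank M A}"
  have "finite ?P" using finite_ground by (intro finite_subset[of ?P "Pow (ground M)"]) auto
  moreover have "A \<in> ?P" using A by simp
  ultimately obtain F where F: "F \<in> ?P" "\<And>H. H \<in> ?P \<Longrightarrow> F \<subseteq> H \<Longrightarrow> H = F"
    using finite_has_maximal2[of ?P A] by (metis (no_types, lifting))
  have "flat M F"
    unfolding flat_def
  proof (intro conjI ballI)
    show "F \<subseteq> ground M" using F(1) by simp
    fix x assume x: "x \<in> ground M - F"
    then have "insert x F \<notin> ?P" using F(2)[of "insert x F"] by blast
    then have "rank M (insert x F) \<noteq> rank M F" using F(1) x by auto
    then show "rank M F < rank M (insert x F)" using rank_mono[OF subset_insertI, of F x] by linarith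
  qed
  moreover have "cyclic M F" if cyc: "cyclic M A"
  proof -
    have "rank M (F - {x}) = rank M F" if "x \<in> F" for x
    proof -
      have "rank M A = rank M (A - {x})"
        using cyc cyclic_iff_rank by (cases "x \<in> A") auto
      also have "\<dots> \<le> rank M (F - {x})" using F(1) by (intro rank_mono) auto
      finally show ?thesis using F(1) rank_mono[of "F - {x}" F] by auto
    qed
    then show ?thesis using F(1) cyclic_iff_rank by auto
  qed
  moreover have "F \<subseteq> H" if H: "flat M H" "A \<subseteq> H" for H
  proof (rule ccontr)
    assume "\<not> F \<subseteq> H"
    then obtain x where x: "x \<in> F" "x \<notin> H" by blast
    have "H \<union> insert x A = insert x H" "H \<inter> insert x A = A" using H(2) x by auto
    then have "rank M (insert x H) + rank M A \<le> rank M H + rank M (insert x A)"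
      using rank_submodular[of H "insert x A"] by simp
    also have "rank M (insert x A) \<le> rank M F" using F(1) x by (intro rank_mono) auto
    finally have "rank M (insert x H) \<le> rank M H" using F(1) by simp
    moreover have "rank M H < rank M (insert x H)" using H(1) x F(1) by (auto simp: flat_def)
    ultimately show False by simp
  qed
  moreover have "A \<subseteq> F" "rank M F = rank M A" using F(1) by simp_all
  ultimately show ?thesis by (intro exI[of _ F]) simp
qed

text \<open>\<open>Y\<close> is the union of all circuits inside \<open>A\<close>. The elements of
  \<open>A - Y\<close> are coloops of the restriction to \<open>A\<close>, so each of them
  contributes exactly one to the rank.\<close>

lemma ex_cyclic_part:
  assumes A: "A \<subseteq> ground M"
  shows "\<exists>Y. cyclic M Y \<and> Y \<subseteq> A \<and> rank M A = rank M Y + card (A - Y)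
    \<and> (flat M A \<longrightarrow> flat M Y) \<and> (\<forall>W. cyclic M W \<and> W \<subseteq> A \<longrightarrow> W \<subseteq> Y)"
proof -
  define Y where "Y = \<Union>{C \<in> circuits M. C \<subseteq> A}"
  have finA: "finite A" using A finite_ground finite_subset by blast
  have cyc: "cyclic M Y"
    unfolding cyclic_def Y_def by (intro exI[of _ "{C \<in> circuits M. C \<subseteq> A}"]) auto
  have sub: "Y \<subseteq> A" unfolding Y_def by blast
  obtain I where I: "I \<in> indep M" "I \<subseteq> Y" "card I = rank M Y" by (rule rank_attained)
  have "I \<union> (A - Y) \<in> indep M"
  proof (rule ccontr)
    assume dep: "\<not> ?thesis"
    have "I \<union> (A - Y) \<subseteq> ground M" using I(2) sub A by blast
    from dependent_contains_circuit[OF this dep]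
    obtain C where C: "C \<in> circuits M" "C \<subseteq> I \<union> (A - Y)" by blast
    then have "C \<subseteq> Y" unfolding Y_def using I(2) sub by blast
    then have "C \<subseteq> I" using C(2) by blast
    then show False using C(1) indep_mono[OF I(1)] by (auto simp: circuits_def)
  qed
  then have "card (I \<union> (A - Y)) \<le> rank M A" using I(2) sub by (intro indep_card_le_rank) auto
  moreover have "I \<inter> (A - Y) = {}" using I(2) by blast
  then have "card (I \<union> (A - Y)) = card I + card (A - Y)"
    using finA indep_finite[OF I(1)] by (simp add: card_Un_disjoint)
  ultimately have r: "rank M A = rank M Y + card (A - Y)"
    using rank_le_diff[OF finA, of Y] I(3) by simp
  have fl_part: "flat M Y" if fl: "flat M A"
    unfolding flat_def
  proof (intro conjI ballI)
    show "Y \<subseteq> ground M" using sub A by blast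
    fix x assume x: "x \<in> ground M - Y"
    show "rank M Y < rank M (insert x Y)"
    proof (rule ccontr)
      assume "\<not> ?thesis"
      then have "rank M (insert x Y - {x}) = rank M (insert x Y)"
        using rank_mono[OF subset_insertI, of Y x] x by simp
      then obtain C where C: "C \<in> circuits M" "C \<subseteq> insert x Y" "x \<in> C"
        by (rule circuit_through[rotated 2]) (use x sub A in auto)
      \<comment> \<open>A circuit through \<open>x\<close> in \<open>insert x Y\<close> either lies
        inside \<open>A\<close>, and is then part of \<open>Y\<close>, or puts \<open>x\<close> into
        the closure of the flat \<open>A\<close>.\<close>
      show False
      proof (cases "x \<in> A")
        case True
        then have "C \<subseteq> Y" unfolding Y_def using C sub by blast
        then show False using C x by blast
      next
        case False
        then have "rank M A < rank M (insert x A)" using fl x by (auto simp: flat_def)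
        moreover have "rank M (insert x A - {x}) = rank M (insert x A)"
          by (rule rank_Diff_circuit[OF C(1) _ C(3)]) (use C(2) sub in blast)
        moreover have "insert x A - {x} = A" using False by blast
        ultimately show False by simp
      qed
    qed
  qed
  have "W \<subseteq> Y" if W: "cyclic M W" "W \<subseteq> A" for W
  proof -
    obtain \<C> where C: "\<C> \<subseteq> circuits M" "W = \<Union>\<C>" using W(1) unfolding cyclic_def by blast
    have "\<C> \<subseteq> {C \<in> circuits M. C \<subseteq> A}"
    proof
      fix D assume D: "D \<in> \<C>"
      then have "D \<subseteq> A" using C(2) W(2) by blast
      then show "D \<in> {C \<in> circuits M. C \<subseteq> A}" using C(1) D by blast
    qed
    then show ?thesis unfolding C(2) Y_def by (rule Union_mono)
  qed
  then show ?thesis using cyc sub r fl_part by (intro exI[of _ Y]) simp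
qed

lemma cyclic_flats_join:
  assumes "X \<in> cyclic_flats M" "Y \<in> cyclic_flats M"
  shows "\<exists>J \<in> cyclic_flats M. X \<union> Y \<subseteq> J \<and> rank M J = rank M (X \<union> Y)
    \<and> (\<forall>W \<in> cyclic_flats M. X \<union> Y \<subseteq> W \<longrightarrow> J \<subseteq> W)"
proof -
  have cyc: "cyclic M (X \<union> Y)" using assms cyclic_Un by (simp add: cyclic_flats_def)
  then have "X \<union> Y \<subseteq> ground M" by (rule cyclic_subset)
  from ex_closure[OF this] obtain F where "flat M F \<and> X \<union> Y \<subseteq> F \<and> rank M F = rank M (X \<union> Y)
    \<and> (cyclic M (X \<union> Y) \<longrightarrow> cyclic M F) \<and> (\<forall>H. flat M H \<and> X \<union> Y \<subseteq> H \<longrightarrow> F \<subseteq> H)"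
    by (rule exE)
  then show ?thesis using cyc by (intro bexI[of _ F]) (simp_all add: cyclic_flats_def)
qed

text \<open>The closure of the intersection is contained in both flats, hence adds nothing.\<close>

lemma flat_Int:
  assumes "flat M X" "flat M Y" shows "flat M (X \<inter> Y)"
proof -
  have "X \<inter> Y \<subseteq> ground M" using assms by (auto simp: flat_def)
  from ex_closure[OF this] obtain F where F: "flat M F" "X \<inter> Y \<subseteq> F"
    "\<forall>H. flat M H \<and> X \<inter> Y \<subseteq> H \<longrightarrow> F \<subseteq> H" by blast
  then have "F = X \<inter> Y" using assms by (simp add: eq_iff)
  then show ?thesis using F(1) by simp
qed

text \<open>The meet is the cyclic part of the intersection. Its rank falls short of that of
  \<open>X \<inter> Y\<close> by the number of discarded coloops, which is the origin of the
  cardinality term in the join-meet inequality.\<close>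

lemma cyclic_flats_meet:
  assumes "X \<in> cyclic_flats M" "Y \<in> cyclic_flats M"
  shows "\<exists>K \<in> cyclic_flats M. K \<subseteq> X \<inter> Y
    \<and> rank M (X \<inter> Y) = rank M K + card (X \<inter> Y - K)
    \<and> (\<forall>W \<in> cyclic_flats M. W \<subseteq> X \<inter> Y \<longrightarrow> W \<subseteq> K)"
proof -
  have fl: "flat M (X \<inter> Y)" using assms flat_Int by (simp add: cyclic_flats_def)
  then have "X \<inter> Y \<subseteq> ground M" unfolding flat_def by blast
  from ex_cyclic_part[OF this] obtain K where "cyclic M K" "K \<subseteq> X \<inter> Y"
    "rank M (X \<inter> Y) = rank M K + card (X \<inter> Y - K)" "flat M K"
    "\<forall>W. cyclic M W \<and> W \<subseteq> X \<inter> Y \<longrightarrow> W \<subseteq> K"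
    using fl by blast
  then show ?thesis by (intro bexI[of _ K]) (simp_all add: cyclic_flats_def)
qed

text \<open>The closure of the cyclic part of \<open>A\<close> does it. Together with
  \<open>rank_le_diff\<close> this shows that the rank of \<open>A\<close> is the minimum of r(W) +
  |A - W| over the cyclic flats W.\<close>

lemma rank_via_cyclic_flat:
  assumes "A \<subseteq> ground M"
  shows "\<exists>W \<in> cyclic_flats M. rank M A = rank M W + card (A - W)"
proof -
  have fin: "finite A" using assms finite_ground finite_subset by blast
  from ex_cyclic_part[OF assms]
  obtain Y where Y: "cyclic M Y" "Y \<subseteq> A" "rank M A = rank M Y + card (A - Y)" by blast
  have "Y \<subseteq> ground M" using Y(2) assms by blast
  from ex_closure[OF this]
  obtain W where W: "flat M W" "Y \<subseteq> W" "rank M W = rank M Y" "cyclic M W" using Y(1) by blast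
  have "card (A - W) \<le> card (A - Y)" using W(2) fin by (intro card_mono) auto
  then have "rank M A = rank M W + card (A - W)"
    using rank_le_diff[OF fin, of W] Y(3) W(3) by simp
  then show ?thesis using W by (intro bexI[of _ W]) (simp_all add: cyclic_flats_def)
qed

lemma indep_iff_cyclic_flats:
  "I \<in> indep M \<longleftrightarrow> I \<subseteq> ground M \<and> (\<forall>W \<in> cyclic_flats M. card (I \<inter> W) \<le> rank M W)"
proof
  assume I: "I \<in> indep M"
  have "card (I \<inter> W) \<le> rank M W" for W
    by (rule indep_card_le_rank[OF indep_mono[OF I]]) auto
  then show "I \<subseteq> ground M \<and> (\<forall>W \<in> cyclic_flats M. card (I \<inter> W) \<le> rank M W)"
    using I indep_subset by blast
next
  assume I: "I \<subseteq> ground M \<and> (\<forall>W \<in> cyclic_flats M. card (I \<inter> W) \<le> rank M W)"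
  then obtain W where W: "W \<in> cyclic_flats M" "rank M I = rank M W + card (I - W)"
    using rank_via_cyclic_flat by blast
  have fin: "finite I" using I finite_ground finite_subset by blast
  have "card I = card (I \<inter> W) + card (I - W)" using fin by (metis card_Int_Diff)
  then have "card I \<le> rank M I" using I W by auto
  then show "I \<in> indep M" using I rank_le_card[OF fin] indep_iff_rank by auto
qed

end

section \<open>Matroids from rank functions\<close>

definition rank_matroid :: "'a set \<Rightarrow> ('a set \<Rightarrow> int) \<Rightarrow> 'a indep_system" where
  "rank_matroid E f = \<lparr>ground = E, indep = {I. I \<subseteq> E \<and> f I = int (card I)}\<rparr>"

text \<open>Monotonicity and unit increase are required for single elements only, where they are
  easy to check for a minimum or a dual rank; \<open>f_Un\<close> recovers the general forms. Values
  are integers so that differences can be handled without truncation.\<close>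

locale rank_function =
  fixes E :: "'a set" and f :: "'a set \<Rightarrow> int"
  assumes finite_E: "finite E"
    and f_empty: "f {} = 0"
    and f_insert_ge: "\<lbrakk>A \<subseteq> E; x \<in> E\<rbrakk> \<Longrightarrow> f A \<le> f (insert x A)"
    and f_insert_le: "\<lbrakk>A \<subseteq> E; x \<in> E\<rbrakk> \<Longrightarrow> f (insert x A) \<le> f A + 1"
    and f_submodular: "\<lbrakk>A \<subseteq> E; B \<subseteq> E\<rbrakk> \<Longrightarrow> f (A \<union> B) + f (A \<inter> B) \<le> f A + f B"
begin

lemma f_Un: "A \<subseteq> E \<Longrightarrow> B \<subseteq> E \<Longrightarrow> f A \<le> f (A \<union> B) \<and> f (A \<union> B) \<le> f A + int (card B)"
proof -
  assume A: "A \<subseteq> E" and B: "B \<subseteq> E"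
  have "finite B" using B finite_E finite_subset by blast
  then show ?thesis using B
  proof (induction B)
    case (insert x B)
    then have "A \<union> B \<subseteq> E" "x \<in> E" using A by auto
    then show ?case using insert f_insert_ge[of "A \<union> B" x] f_insert_le[of "A \<union> B" x] by simp
  qed simp
qed

lemma f_mono: "A \<subseteq> B \<Longrightarrow> B \<subseteq> E \<Longrightarrow> f A \<le> f B"
  using f_Un[of A B] by (simp add: sup.absorb2)

lemma f_le_card: "A \<subseteq> E \<Longrightarrow> f A \<le> int (card A)"
  using f_Un[of "{}" A] f_empty by simp

text \<open>This is the closure property hidden in submodularity: elements that individually do not
  raise \<open>f\<close> over \<open>I\<close> do not raise it jointly. Augmentation is its
  contrapositive.\<close>

lemma f_absorb:
  assumes I: "I \<subseteq> E" and B: "B \<subseteq> E" "\<And>x. x \<in> B - I \<Longrightarrow> f (insert x I) \<le> f I"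
  shows "f (I \<union> B) = f I"
proof -
  have "finite B" using B(1) finite_E finite_subset by blast
  then have "f (I \<union> B) \<le> f I" using B
  proof (induction B)
    case (insert x B)
    show ?case
    proof (cases "x \<in> I \<union> B")
      case True
      then have "I \<union> insert x B = I \<union> B" by blast
      then show ?thesis using insert by simp
    next
      case False
      have "(I \<union> B) \<union> insert x I = I \<union> insert x B" "(I \<union> B) \<inter> insert x I = I"
        using False by auto
      then have "f (I \<union> insert x B) + f I \<le> f (I \<union> B) + f (insert x I)"
        using f_submodular[of "I \<union> B" "insert x I"] insert.prems(1) I by simp
      moreover have "f (insert x I) \<le> f I" using insert.prems(2) False by simp
      moreover have "f (I \<union> B) \<le> f I" using insert by simp
      ultimately show ?thesis by linarith
    qed
  qed simp
  then show ?thesis using f_Un[OF I B(1)] by simp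
qed

lemma indep_rank_matroid: "I \<in> indep (rank_matroid E f) \<longleftrightarrow> I \<subseteq> E \<and> f I = int (card I)"
  by (simp add: rank_matroid_def)

lemma f_augment:
  assumes I: "I \<in> indep (rank_matroid E f)" and A: "A \<subseteq> E" "int (card I) < f A"
  obtains x where "x \<in> A - I" "insert x I \<in> indep (rank_matroid E f)"
proof -
  have IE: "I \<subseteq> E" and fI: "f I = int (card I)" using I indep_rank_matroid by auto
  have finI: "finite I" using IE finite_E finite_subset by blast
  have "\<exists>x \<in> A - I. \<not> f (insert x I) \<le> f I"
  proof (rule ccontr)
    assume "\<not> ?thesis"
    then have "f (I \<union> A) = f I" by (intro f_absorb[OF IE A(1)]) blast
    moreover have "f A \<le> f (I \<union> A)" using IE A(1) by (intro f_mono) auto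
    ultimately show False using A(2) fI by simp
  qed
  then obtain x where x: "x \<in> A - I" "f I < f (insert x I)" by auto
  then have "f (insert x I) = int (card (insert x I))"
    using f_insert_le[OF IE, of x] A(1) fI finI by auto
  then show thesis using that[of x] x A(1) IE indep_rank_matroid by auto
qed

lemma matroid_rank_matroid: "matroid (rank_matroid E f)"
proof
  show "finite (ground (rank_matroid E f))" using finite_E by (simp add: rank_matroid_def)
  show "{} \<in> indep (rank_matroid E f)" by (simp add: indep_rank_matroid f_empty)
  show "I \<subseteq> ground (rank_matroid E f)" if "I \<in> indep (rank_matroid E f)" for I
    using that by (simp add: rank_matroid_def)
  show "J \<in> indep (rank_matroid E f)" if I: "I \<in> indep (rank_matroid E f)" and J: "J \<subseteq> I" for I J
  proof -
    have IE: "I \<subseteq> E" "f I = int (card I)" using I indep_rank_matroid by auto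
    then have fin: "finite I" using finite_E finite_subset by blast
    have "J \<union> (I - J) = I" using J by blast
    then have "f I \<le> f J + int (card (I - J))" using f_Un[of J "I - J"] IE(1) J by auto
    moreover have "card J + card (I - J) = card I"
      using card_Diff_subset[OF finite_subset[OF J fin] J] card_mono[OF fin J] by simp
    moreover have "f J \<le> int (card J)" using f_le_card[of J] IE(1) J by auto
    ultimately have "f J = int (card J)" using IE(2) by linarith
    then show ?thesis using IE(1) J indep_rank_matroid by auto
  qed
  show "\<exists>x \<in> J - I. insert x I \<in> indep (rank_matroid E f)"
    if I: "I \<in> indep (rank_matroid E f)" and J: "J \<in> indep (rank_matroid E f)"
      and c: "card I < card J" for I J
  proof -
    have "J \<subseteq> E" "int (card I) < f J" using J c by (auto simp: indep_rank_matroid)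
    from f_augment[OF I this] show ?thesis by blast
  qed
qed

lemma rank_rank_matroid:
  assumes A: "A \<subseteq> E"
  shows "int (rank (rank_matroid E f) A) = f A"
proof -
  interpret R: matroid "rank_matroid E f" by (rule matroid_rank_matroid)
  obtain I where I: "I \<in> indep (rank_matroid E f)" "I \<subseteq> A" "card I = rank (rank_matroid E f) A"
    by (rule R.rank_attained)
  have "f A \<le> int (card I)"
  proof (rule ccontr)
    assume "\<not> ?thesis"
    then obtain x where x: "x \<in> A - I" "insert x I \<in> indep (rank_matroid E f)"
      using f_augment[OF I(1) A] by force
    then have "card (insert x I) \<le> rank (rank_matroid E f) A"
      using I(2) by (intro R.indep_card_le_rank) auto
    then show False using x(1) I(3) R.indep_finite[OF I(1)] by auto
  qed
  moreover have "int (card I) \<le> f A" using f_mono[OF I(2) A] I(1) by (simp add: indep_rank_matroid)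
  ultimately show ?thesis using I(3) by simp
qed

end

section \<open>The cyclic flat axioms determine a matroid\<close>

lemma lattice_inclusion_orderI:
  assumes "\<And>X Y. X \<in> \<Z> \<Longrightarrow> Y \<in> \<Z> \<Longrightarrow> \<exists>J \<in> \<Z>. X \<union> Y \<subseteq> J \<and> (\<forall>W \<in> \<Z>. X \<union> Y \<subseteq> W \<longrightarrow> J \<subseteq> W)"
    and "\<And>X Y. X \<in> \<Z> \<Longrightarrow> Y \<in> \<Z> \<Longrightarrow> \<exists>K \<in> \<Z>. K \<subseteq> X \<inter> Y \<and> (\<forall>W \<in> \<Z>. W \<subseteq> X \<inter> Y \<longrightarrow> W \<subseteq> K)"
  shows "Lattice.lattice (inclusion_order \<Z>)"
proof -
  interpret partial_order "inclusion_order \<Z>" by unfold_locales auto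
  show ?thesis
  proof unfold_locales
    fix X Y assume "X \<in> carrier (inclusion_order \<Z>)" "Y \<in> carrier (inclusion_order \<Z>)"
    then have XY: "X \<in> \<Z>" "Y \<in> \<Z>" by simp_all
    show "\<exists>s. least (inclusion_order \<Z>) s (Upper (inclusion_order \<Z>) {X, Y})"
    proof -
      from assms(1)[OF XY] obtain J where
        "J \<in> \<Z>" "X \<union> Y \<subseteq> J" "\<forall>W \<in> \<Z>. X \<union> Y \<subseteq> W \<longrightarrow> J \<subseteq> W" by auto
      then show ?thesis using XY by (intro exI[of _ J]) (auto simp: least_def Upper_def)
    qed
    show "\<exists>s. greatest (inclusion_order \<Z>) s (Lower (inclusion_order \<Z>) {X, Y})"
    proof -
      from assms(2)[OF XY] obtain K where
        "K \<in> \<Z>" "K \<subseteq> X \<inter> Y" "\<forall>W \<in> \<Z>. W \<subseteq> X \<inter> Y \<longrightarrow> W \<subseteq> K" by auto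
      then show ?thesis using XY by (intro exI[of _ K]) (auto simp: greatest_def Lower_def)
    qed
  qed
qed

lemma inclusion_order_join:
  assumes "Lattice.lattice (inclusion_order \<Z>)" "X \<in> \<Z>" "Y \<in> \<Z>"
  shows "X \<squnion>\<^bsub>inclusion_order \<Z>\<^esub> Y \<in> \<Z>" "X \<union> Y \<subseteq> X \<squnion>\<^bsub>inclusion_order \<Z>\<^esub> Y"
    "W \<in> \<Z> \<Longrightarrow> X \<union> Y \<subseteq> W \<Longrightarrow> X \<squnion>\<^bsub>inclusion_order \<Z>\<^esub> Y \<subseteq> W"
proof -
  interpret L: Lattice.lattice "inclusion_order \<Z>" by fact
  show "X \<squnion>\<^bsub>inclusion_order \<Z>\<^esub> Y \<in> \<Z>" using L.join_closed[of X Y] assms by simp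
  show "X \<union> Y \<subseteq> X \<squnion>\<^bsub>inclusion_order \<Z>\<^esub> Y"
    using L.join_left[of X Y] L.join_right[of X Y] assms by simp
  show "X \<squnion>\<^bsub>inclusion_order \<Z>\<^esub> Y \<subseteq> W" if "W \<in> \<Z>" "X \<union> Y \<subseteq> W"
    using L.join_le[of X W Y] assms that by simp
qed

lemma inclusion_order_meet:
  assumes "Lattice.lattice (inclusion_order \<Z>)" "X \<in> \<Z>" "Y \<in> \<Z>"
  shows "X \<sqinter>\<^bsub>inclusion_order \<Z>\<^esub> Y \<in> \<Z>" "X \<sqinter>\<^bsub>inclusion_order \<Z>\<^esub> Y \<subseteq> X \<inter> Y"
    "W \<in> \<Z> \<Longrightarrow> W \<subseteq> X \<inter> Y \<Longrightarrow> W \<subseteq> X \<sqinter>\<^bsub>inclusion_order \<Z>\<^esub> Y"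
proof -
  interpret L: Lattice.lattice "inclusion_order \<Z>" by fact
  show "X \<sqinter>\<^bsub>inclusion_order \<Z>\<^esub> Y \<in> \<Z>" using L.meet_closed[of X Y] assms by simp
  show "X \<sqinter>\<^bsub>inclusion_order \<Z>\<^esub> Y \<subseteq> X \<inter> Y"
    using L.meet_left[of X Y] L.meet_right[of X Y] assms by simp
  show "W \<subseteq> X \<sqinter>\<^bsub>inclusion_order \<Z>\<^esub> Y" if "W \<in> \<Z>" "W \<subseteq> X \<inter> Y"
    using L.meet_le[of W X Y] assms that by simp
qed

text \<open>Comparable sets have their union and intersection as join and meet, so witnesses are
  needed only for incomparable pairs. The universal properties of \<open>J\<close> and
  \<open>K\<close> identify them with the lattice operations, which are otherwise given only by a
  choice operator.\<close>

lemma cyclic_flat_axiomsI: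
  assumes least: "Z\<^sub>0 \<in> \<Z>" "\<And>X. X \<in> \<Z> \<Longrightarrow> Z\<^sub>0 \<subseteq> X" "r Z\<^sub>0 = 0"
    and gap: "\<And>X Y. \<lbrakk>X \<in> \<Z>; Y \<in> \<Z>; X \<subset> Y\<rbrakk> \<Longrightarrow> 0 < r Y - r X \<and> r Y - r X < int (card (Y - X))"
    and inc: "\<And>X Y. \<lbrakk>X \<in> \<Z>; Y \<in> \<Z>; \<not> X \<subseteq> Y; \<not> Y \<subseteq> X\<rbrakk> \<Longrightarrow> \<exists>J \<in> \<Z>. \<exists>K \<in> \<Z>.
      X \<union> Y \<subseteq> J \<and> (\<forall>W \<in> \<Z>. X \<union> Y \<subseteq> W \<longrightarrow> J \<subseteq> W) \<and>
      K \<subseteq> X \<inter> Y \<and> (\<forall>W \<in> \<Z>. W \<subseteq> X \<inter> Y \<longrightarrow> W \<subseteq> K) \<and>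
      r J + r K + int (card (X \<inter> Y - K)) \<le> r X + r Y"
  shows "cyclic_flat_axioms \<Z> r"
proof -
  let ?L = "inclusion_order \<Z>"
  have lat: "Lattice.lattice ?L"
  proof (rule lattice_inclusion_orderI)
    fix X Y assume XY: "X \<in> \<Z>" "Y \<in> \<Z>"
    show "\<exists>J \<in> \<Z>. X \<union> Y \<subseteq> J \<and> (\<forall>W \<in> \<Z>. X \<union> Y \<subseteq> W \<longrightarrow> J \<subseteq> W)"
    proof (cases "X \<subseteq> Y \<or> Y \<subseteq> X")
      case True
      then have "X \<union> Y \<in> \<Z>" using XY by (auto simp: sup.absorb1 sup.absorb2)
      then show ?thesis by (intro bexI[of _ "X \<union> Y"]) auto
    next
      case False
      then show ?thesis using inc[OF XY] by meson
    qed
    show "\<exists>K \<in> \<Z>. K \<subseteq> X \<inter> Y \<and> (\<forall>W \<in> \<Z>. W \<subseteq> X \<inter> Y \<longrightarrow> W \<subseteq> K)"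
    proof (cases "X \<subseteq> Y \<or> Y \<subseteq> X")
      case True
      then have "X \<inter> Y \<in> \<Z>" using XY by (auto simp: inf.absorb1 inf.absorb2)
      then show ?thesis by (intro bexI[of _ "X \<inter> Y"]) auto
    next
      case False
      then show ?thesis using inc[OF XY] by meson
    qed
  qed
  have sub: "r (X \<squnion>\<^bsub>?L\<^esub> Y) + r (X \<sqinter>\<^bsub>?L\<^esub> Y) + int (card ((X \<inter> Y) - (X \<sqinter>\<^bsub>?L\<^esub> Y))) \<le> r X + r Y"
    if XY: "X \<in> \<Z>" "Y \<in> \<Z>" and "\<not> X \<subseteq> Y" "\<not> Y \<subseteq> X" for X Y
  proof -
    from inc[OF that] obtain J K where JK: "J \<in> \<Z>" "K \<in> \<Z>" "X \<union> Y \<subseteq> J"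
      "\<forall>W \<in> \<Z>. X \<union> Y \<subseteq> W \<longrightarrow> J \<subseteq> W" "K \<subseteq> X \<inter> Y" "\<forall>W \<in> \<Z>. W \<subseteq> X \<inter> Y \<longrightarrow> W \<subseteq> K"
      "r J + r K + int (card (X \<inter> Y - K)) \<le> r X + r Y" by metis
    have "J = X \<squnion>\<^bsub>?L\<^esub> Y"
      by (rule equalityI) (use JK inclusion_order_join[OF lat XY] in simp_all)
    moreover have "K = X \<sqinter>\<^bsub>?L\<^esub> Y"
      by (rule equalityI) (use JK inclusion_order_meet[OF lat XY] in simp_all)
    ultimately show ?thesis using JK(7) by simp
  qed
  have "least ?L Z\<^sub>0 \<Z>" using least by (auto simp: least_def)
  then show ?thesis using lat gap sub least(3) unfolding cyclic_flat_axioms_def Let_def by blast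
qed

locale cyclic_flat_system =
  fixes E :: "'a set" and \<Z> :: "'a set set" and r :: "'a set \<Rightarrow> int"
  assumes finite_E: "finite E" and subsets: "\<Z> \<subseteq> Pow E" and axms: "cyclic_flat_axioms \<Z> r"
begin

lemma finite_member: "X \<in> \<Z> \<Longrightarrow> finite X"
  using subsets finite_E finite_subset by blast

lemma gap: "\<lbrakk>X \<in> \<Z>; Y \<in> \<Z>; X \<subset> Y\<rbrakk> \<Longrightarrow> 0 < r Y - r X \<and> r Y - r X < int (card (Y - X))"
  using axms unfolding cyclic_flat_axioms_def Let_def by simp

lemma bottom: obtains Z\<^sub>0 where "Z\<^sub>0 \<in> \<Z>" "r Z\<^sub>0 = 0" "\<forall>X \<in> \<Z>. Z\<^sub>0 \<subseteq> X"
  using axms unfolding cyclic_flat_axioms_def Let_def least_def by auto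

text \<open>Comparable pairs are included, with equality and an empty cardinality term, so that
  later arguments need no case distinction.\<close>

lemma join_meet:
  assumes XY: "X \<in> \<Z>" "Y \<in> \<Z>"
  obtains J K where "J \<in> \<Z>" "K \<in> \<Z>" "X \<union> Y \<subseteq> J" "K \<subseteq> X \<inter> Y"
    "r J + r K + int (card (X \<inter> Y - K)) \<le> r X + r Y"
proof (cases "X \<subseteq> Y \<or> Y \<subseteq> X")
  case True
  then have "X \<union> Y = X \<and> X \<inter> Y = Y \<or> X \<union> Y = Y \<and> X \<inter> Y = X" by blast
  then have "X \<union> Y \<in> \<Z>" "X \<inter> Y \<in> \<Z>" "r (X \<union> Y) + r (X \<inter> Y) = r X + r Y" using XY by auto
  then show thesis using that[of "X \<union> Y" "X \<inter> Y"] by simp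
next
  case False
  have lat: "Lattice.lattice (inclusion_order \<Z>)"
    using axms unfolding cyclic_flat_axioms_def Let_def by simp
  show thesis
  proof (rule that)
    show "r (X \<squnion>\<^bsub>inclusion_order \<Z>\<^esub> Y) + r (X \<sqinter>\<^bsub>inclusion_order \<Z>\<^esub> Y)
      + int (card (X \<inter> Y - X \<sqinter>\<^bsub>inclusion_order \<Z>\<^esub> Y)) \<le> r X + r Y"
      using axms XY False unfolding cyclic_flat_axioms_def Let_def by simp
  qed (use inclusion_order_join[OF lat XY] inclusion_order_meet[OF lat XY] in simp_all)
qed

lemma r_nonneg: assumes "X \<in> \<Z>" shows "0 \<le> r X"
proof -
  obtain Z\<^sub>0 where "Z\<^sub>0 \<in> \<Z>" "r Z\<^sub>0 = 0" "\<forall>X \<in> \<Z>. Z\<^sub>0 \<subseteq> X" by (rule bottom)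
  then show ?thesis using gap[of Z\<^sub>0 X] assms by (cases "Z\<^sub>0 = X") (auto simp: psubset_eq)
qed

text \<open>If \<open>W\<close> lies below \<open>X\<close>, this is the upper gap bound. Otherwise
  the join \<open>J\<close> strictly contains \<open>X\<close>, so r(J) > r(X) supplies the
  strictness; the join-meet inequality and the gap bound from the meet \<open>K\<close> up to
  \<open>X\<close> do the rest.\<close>

lemma separation:
  assumes "X \<in> \<Z>" "W \<in> \<Z>" "W \<noteq> X"
  shows "r X < r W + int (card (X - W))"
proof -
  obtain J K where JK: "J \<in> \<Z>" "K \<in> \<Z>" "X \<union> W \<subseteq> J" "K \<subseteq> X \<inter> W"
    "r J + r K + int (card (X \<inter> W - K)) \<le> r X + r W"
    using join_meet[OF assms(1,2)] by metis
  consider "W \<subset> X" | "X \<subset> J" using JK(3) assms(3) by blast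
  then show ?thesis
  proof cases
    case 1
    then show ?thesis using gap[OF assms(2,1)] by simp
  next
    case 2
    then have "r X < r J" using gap[OF assms(1) JK(1)] by simp
    moreover have "r X \<le> r K + int (card (X - K))"
      using gap[OF JK(2) assms(1)] JK(4) by (cases "K = X") (auto simp: psubset_eq)
    moreover have "card (X - K) = card (X \<inter> W - K) + card (X - W)"
    proof -
      have "X - K = (X \<inter> W - K) \<union> (X - W)" using JK(4) by blast
      then show ?thesis
        using card_Un_disjoint[of "X \<inter> W - K" "X - W"] finite_member[OF assms(1)] by auto
    qed
    ultimately show ?thesis using JK(5) by linarith
  qed
qed

section \<open>The rank function of a cyclic flat system\<close>

definition \<rho> :: "'a set \<Rightarrow> int" where
  "\<rho> A = Min ((\<lambda>Z. r Z + int (card (A - Z))) ` \<Z>)"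

lemma finite_\<Z>: "finite \<Z>"
  using subsets finite_E finite_subset by blast

lemma \<rho>_le: "Z \<in> \<Z> \<Longrightarrow> \<rho> A \<le> r Z + int (card (A - Z))"
  unfolding \<rho>_def using finite_\<Z> by simp

lemma \<rho>_attained: obtains Z where "Z \<in> \<Z>" "\<rho> A = r Z + int (card (A - Z))"
proof -
  have "\<Z> \<noteq> {}" using bottom by blast
  then have "\<rho> A \<in> (\<lambda>Z. r Z + int (card (A - Z))) ` \<Z>"
    unfolding \<rho>_def using finite_\<Z> by (intro Min_in) auto
  then show thesis using that by blast
qed

sublocale rank_function E \<rho>
proof
  show "finite E" by (rule finite_E)
  obtain Z\<^sub>0 where "Z\<^sub>0 \<in> \<Z>" "r Z\<^sub>0 = 0" "\<forall>X \<in> \<Z>. Z\<^sub>0 \<subseteq> X" by (rule bottom)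
  moreover obtain Z where "Z \<in> \<Z>" "\<rho> {} = r Z + int (card ({} - Z))" by (rule \<rho>_attained)
  ultimately show "\<rho> {} = 0" using \<rho>_le[of Z\<^sub>0 "{}"] r_nonneg[of Z] by simp
next
  fix A x assume A: "A \<subseteq> E" and x: "x \<in> E"
  have fin: "finite A" using A finite_E finite_subset by blast
  obtain Z where Z: "Z \<in> \<Z>" "\<rho> (insert x A) = r Z + int (card (insert x A - Z))"
    by (rule \<rho>_attained)
  have "card (A - Z) \<le> card (insert x A - Z)" using fin by (intro card_mono) auto
  then show "\<rho> A \<le> \<rho> (insert x A)" using \<rho>_le[OF Z(1), of A] Z(2) by linarith
  obtain W where W: "W \<in> \<Z>" "\<rho> A = r W + int (card (A - W))"
    by (rule \<rho>_attained)
  have "card (insert x A - W) \<le> card (insert x (A - W))" using fin by (intro card_mono) auto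
  also have "\<dots> \<le> Suc (card (A - W))" by (rule card_insert_le_m1) auto
  finally show "\<rho> (insert x A) \<le> \<rho> A + 1" using \<rho>_le[OF W(1), of "insert x A"] W(2) by linarith
next
  fix A B assume "A \<subseteq> E" "B \<subseteq> E"
  then have fin: "finite A" "finite B" using finite_E finite_subset by blast+
  obtain X where X: "X \<in> \<Z>" "\<rho> A = r X + int (card (A - X))" by (rule \<rho>_attained)
  obtain Y where Y: "Y \<in> \<Z>" "\<rho> B = r Y + int (card (B - Y))" by (rule \<rho>_attained)
  obtain J K where JK: "J \<in> \<Z>" "K \<in> \<Z>" "X \<union> Y \<subseteq> J" "K \<subseteq> X \<inter> Y"
    "r J + r K + int (card (X \<inter> Y - K)) \<le> r X + r Y"
    using join_meet[OF X(1) Y(1)] by metis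
  \<comment> \<open>The minimizers \<open>X\<close> and \<open>Y\<close> give the candidates
    \<open>J\<close> for the union and \<open>K\<close> for the intersection. An element of
    \<open>?P\<close> avoids both \<open>X\<close> and \<open>Y\<close>; an element of
    \<open>?Q\<close> avoids one of them or lies in \<open>X \<inter> Y - K\<close>; an element of
    both \<open>?P\<close> and \<open>?Q\<close> is counted in \<open>A - X\<close> and in
    \<open>B - Y\<close>. So the counts on the left exceed those on the right by at most the
    cardinality term of the join-meet inequality.\<close>
  let ?P = "A \<union> B - J" and ?Q = "A \<inter> B - K"
  have finX: "finite X" using X(1) by (rule finite_member)
  have "card (?P \<union> ?Q) \<le> card ((A - X) \<union> (B - Y) \<union> (X \<inter> Y - K))"
    using fin finX JK(3) by (intro card_mono) auto
  also have "\<dots> \<le> card ((A - X) \<union> (B - Y)) + card (X \<inter> Y - K)" by (rule card_Un_le)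
  finally have 1: "card (?P \<union> ?Q) \<le> card ((A - X) \<union> (B - Y)) + card (X \<inter> Y - K)" .
  have 2: "card (?P \<inter> ?Q) \<le> card ((A - X) \<inter> (B - Y))"
    using fin JK(3) by (intro card_mono) auto
  have "card ?P + card ?Q = card (?P \<union> ?Q) + card (?P \<inter> ?Q)"
    using fin by (intro card_Un_Int) auto
  moreover have "card (A - X) + card (B - Y)
    = card ((A - X) \<union> (B - Y)) + card ((A - X) \<inter> (B - Y))"
    using fin by (intro card_Un_Int) auto
  ultimately have "card ?P + card ?Q \<le> card (A - X) + card (B - Y) + card (X \<inter> Y - K)"
    using 1 2 by linarith
  then show "\<rho> (A \<union> B) + \<rho> (A \<inter> B) \<le> \<rho> A + \<rho> B"
    using \<rho>_le[OF JK(1), of "A \<union> B"] \<rho>_le[OF JK(2), of "A \<inter> B"] X(2) Y(2) JK(5) by linarith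
qed

lemma \<rho>_member: "X \<in> \<Z> \<Longrightarrow> \<rho> X = r X"
proof -
  assume X: "X \<in> \<Z>"
  obtain W where W: "W \<in> \<Z>" "\<rho> X = r W + int (card (X - W))" by (rule \<rho>_attained)
  have "r X \<le> \<rho> X" using separation[OF X W(1)] W(2) by (cases "W = X") auto
  then show ?thesis using \<rho>_le[OF X, of X] by simp
qed

lemma cyclic_flats_rank_matroid: "cyclic_flats (rank_matroid E \<rho>) = \<Z>"
proof -
  let ?M = "rank_matroid E \<rho>"
  interpret R: matroid ?M by (rule matroid_rank_matroid)
  have gr: "ground ?M = E" by (simp add: rank_matroid_def)
  show ?thesis
  proof (intro equalityI subsetI)
    fix X assume X: "X \<in> \<Z>"
    then have XE: "X \<subseteq> E" and fin: "finite X" using subsets finite_member by auto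
    have "flat ?M X"
      unfolding flat_def gr
    proof (intro conjI ballI)
      fix x assume x: "x \<in> E - X"
      obtain W where W: "W \<in> \<Z>" "\<rho> (insert x X) = r W + int (card (insert x X - W))"
        by (rule \<rho>_attained)
      \<comment> \<open>For the minimizer \<open>W = X\<close> the new point \<open>x\<close> costs
        one; for any other \<open>W\<close> the strict inequality of \<open>separation\<close>
        already suffices.\<close>
      have "card (X - W) \<le> card (insert x X - W)" using fin by (intro card_mono) auto
      then have "r X < \<rho> (insert x X)"
        using separation[OF X W(1)] W(2) x by (cases "W = X") (auto simp: insert_Diff_if)
      then have "\<rho> X < \<rho> (insert x X)" using \<rho>_member[OF X] by simp
      moreover have "insert x X \<subseteq> E" using x XE by blast
      ultimately have "int (rank ?M X) < int (rank ?M (insert x X))"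
        using rank_rank_matroid[OF XE] rank_rank_matroid[of "insert x X"] by simp
      then show "rank ?M X < rank ?M (insert x X)" by simp
    qed (rule XE)
    moreover have "cyclic ?M X"
      unfolding R.cyclic_iff_rank gr
    proof (intro conjI ballI)
      fix x assume x: "x \<in> X"
      obtain W where W: "W \<in> \<Z>" "\<rho> (X - {x}) = r W + int (card (X - {x} - W))"
        by (rule \<rho>_attained)
      \<comment> \<open>Deleting \<open>x\<close> lowers the cardinality by at most one. For
        \<open>W \<noteq> X\<close> the strict inequality of \<open>separation\<close> pays for it;
        for \<open>W = X\<close> nothing is lost.\<close>
      have "card (X - W) \<le> card (insert x (X - {x} - W))" using fin by (intro card_mono) auto
      also have "\<dots> \<le> Suc (card (X - {x} - W))" by (rule card_insert_le_m1) auto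
      finally have "r X \<le> \<rho> (X - {x})"
        using separation[OF X W(1)] W(2) by (cases "W = X") auto
      then have "\<rho> X \<le> \<rho> (X - {x})" using \<rho>_member[OF X] by simp
      moreover have sub: "X - {x} \<subseteq> E" using XE by blast
      ultimately have "int (rank ?M X) \<le> int (rank ?M (X - {x}))"
        using rank_rank_matroid[OF XE] rank_rank_matroid[OF sub] by simp
      then show "rank ?M (X - {x}) = rank ?M X" using R.rank_mono[of "X - {x}" X] by auto
    qed (rule XE)
    ultimately show "X \<in> cyclic_flats ?M" by (simp add: cyclic_flats_def)
  next
    fix A assume "A \<in> cyclic_flats ?M"
    then have fl: "flat ?M A" and cyc: "cyclic ?M A" by (simp_all add: cyclic_flats_def)
    have AE: "A \<subseteq> E" using R.cyclic_subset[OF cyc] gr by simp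
    have fin: "finite A" using AE finite_E finite_subset by blast
    obtain W where W: "W \<in> \<Z>" "\<rho> A = r W + int (card (A - W))" by (rule \<rho>_attained)
    \<comment> \<open>A point of \<open>A\<close> outside the minimizer \<open>W\<close> would lower
      the minimum when deleted, so it would be a coloop of the restriction to \<open>A\<close>. Once
      \<open>A \<subseteq> W\<close> is known, the ranks agree and flatness of \<open>A\<close>
      gives equality.\<close>
    have "A \<subseteq> W"
    proof (rule ccontr)
      assume "\<not> A \<subseteq> W"
      then obtain x where x: "x \<in> A" "x \<notin> W" by blast
      have "card (A - {x} - W) < card (A - W)" using fin x by (intro psubset_card_mono) auto
      then have "\<rho> (A - {x}) < \<rho> A" using \<rho>_le[OF W(1), of "A - {x}"] W(2) by linarith
      moreover have "rank ?M (A - {x}) = rank ?M A" using cyc x R.cyclic_iff_rank by simp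
      moreover have "A - {x} \<subseteq> E" using AE by blast
      ultimately show False using rank_rank_matroid[OF AE] rank_rank_matroid[of "A - {x}"] by simp
    qed
    have WE: "W \<subseteq> E" using W(1) subsets by blast
    have "\<rho> A = \<rho> W" using W \<open>A \<subseteq> W\<close> \<rho>_member[OF W(1)] by (simp add: Diff_eq_empty_iff[THEN iffD2])
    then have "rank ?M A = rank ?M W" using rank_rank_matroid[OF AE] rank_rank_matroid[OF WE] by simp
    then have "A = W" using R.flat_rank_less[OF fl, of W] \<open>A \<subseteq> W\<close> WE gr by auto
    then show "A \<in> \<Z>" using W(1) by simp
  qed
qed

lemma ex_matroid:
  "\<exists>M. matroid M \<and> ground M = E \<and> cyclic_flats M = \<Z> \<and> (\<forall>Y \<in> \<Z>. int (rank M Y) = r Y)"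
proof (intro exI[of _ "rank_matroid E \<rho>"] conjI ballI)
  show "ground (rank_matroid E \<rho>) = E" by (simp add: rank_matroid_def)
  show "int (rank (rank_matroid E \<rho>) Y) = r Y" if "Y \<in> \<Z>" for Y
    using rank_rank_matroid[of Y] \<rho>_member[OF that] that subsets by auto
qed (rule matroid_rank_matroid cyclic_flats_rank_matroid)+

end

section \<open>Duals and free coextensions\<close>

context matroid
begin

lemma basis_iff: "basis M B \<longleftrightarrow> B \<in> indep M \<and> card B = rank M (ground M)"
proof
  assume B: "basis M B"
  then have i: "B \<in> indep M" by (simp add: basis_def)
  then obtain K where K: "K \<in> indep M" "B \<subseteq> K" "K \<subseteq> ground M" "card K = rank M (ground M)"
    using indep_extend[of B "ground M"] indep_subset by blast
  then have "K = B" using B by (auto simp: basis_def)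
  then show "B \<in> indep M \<and> card B = rank M (ground M)" using K i by simp
next
  assume B: "B \<in> indep M \<and> card B = rank M (ground M)"
  have "I = B" if I: "I \<in> indep M" "B \<subseteq> I" for I
  proof -
    have "card I \<le> card B" using indep_card_le_rank[OF I(1) indep_subset[OF I(1)]] B by simp
    then show ?thesis using I indep_finite by (metis card_seteq)
  qed
  then show "basis M B" using B by (simp add: basis_def)
qed

lemma dual_indep_iff:
  "I \<in> indep (dual M) \<longleftrightarrow> I \<subseteq> ground M \<and> rank M (ground M - I) = rank M (ground M)"
proof
  assume "I \<in> indep (dual M)"
  then obtain B where B: "basis M B" "I \<subseteq> ground M - B" by (auto simp: dual_def)
  then have "B \<in> indep M" "card B = rank M (ground M)" using basis_iff by auto
  moreover from this have "B \<subseteq> ground M - I" using B(2) indep_subset by blast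
  ultimately have "rank M (ground M) \<le> rank M (ground M - I)"
    using indep_card_le_rank by metis
  then show "I \<subseteq> ground M \<and> rank M (ground M - I) = rank M (ground M)"
    using B(2) rank_mono[of "ground M - I" "ground M"] by auto
next
  assume I: "I \<subseteq> ground M \<and> rank M (ground M - I) = rank M (ground M)"
  obtain B where "B \<in> indep M" "B \<subseteq> ground M - I" "card B = rank M (ground M - I)"
    by (rule rank_attained)
  then have "basis M B" "I \<subseteq> ground M - B" using I basis_iff by auto
  then show "I \<in> indep (dual M)" by (auto simp: dual_def)
qed

text \<open>The corank function. It is introduced before \<open>dual M\<close> is known to be a
  matroid, since that fact is obtained by recognising \<open>dual M\<close> as the matroid of this
  function.\<close>

definition dual_rank :: "'a set \<Rightarrow> int" where
  "dual_rank A = int (card A) + int (rank M (ground M - A)) - int (rank M (ground M))"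

lemma rank_function_dual_rank: "rank_function (ground M) dual_rank"
proof
  fix A x assume A: "A \<subseteq> ground M" and x: "x \<in> ground M"
  have finA: "finite A" using A finite_ground finite_subset by blast
  show "dual_rank A \<le> dual_rank (insert x A)" "dual_rank (insert x A) \<le> dual_rank A + 1"
  proof -
    have "x \<notin> A \<Longrightarrow> insert x (ground M - insert x A) = ground M - A" using x by blast
    then have "x \<notin> A \<Longrightarrow> rank M (ground M - A) \<le> Suc (rank M (ground M - insert x A))"
      using rank_insert_le[of x "ground M - insert x A"] by simp
    moreover have "rank M (ground M - insert x A) \<le> rank M (ground M - A)"
      by (rule rank_mono) blast
    ultimately show "dual_rank A \<le> dual_rank (insert x A)"
      "dual_rank (insert x A) \<le> dual_rank A + 1"
      using finA unfolding dual_rank_def by (cases "x \<in> A"; simp add: insert_absorb)+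
  qed
next
  fix A B assume A: "A \<subseteq> ground M" and B: "B \<subseteq> ground M"
  then have "finite A" "finite B" using finite_ground finite_subset by blast+
  then have "card A + card B = card (A \<union> B) + card (A \<inter> B)" by (rule card_Un_Int)
  moreover have "(ground M - A) \<union> (ground M - B) = ground M - (A \<inter> B)"
    "(ground M - A) \<inter> (ground M - B) = ground M - (A \<union> B)" by auto
  then have "rank M (ground M - A \<inter> B) + rank M (ground M - (A \<union> B))
      \<le> rank M (ground M - A) + rank M (ground M - B)"
    using rank_submodular[of "ground M - A" "ground M - B"] by simp
  ultimately show "dual_rank (A \<union> B) + dual_rank (A \<inter> B) \<le> dual_rank A + dual_rank B"
    unfolding dual_rank_def by linarith
qed (simp_all add: finite_ground dual_rank_def)

lemma dual_eq_rank_matroid: "dual M = rank_matroid (ground M) dual_rank"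
proof -
  have "indep (dual M) = indep (rank_matroid (ground M) dual_rank)"
    using dual_indep_iff
    by (auto simp: rank_function.indep_rank_matroid[OF rank_function_dual_rank] dual_rank_def)
  then show ?thesis by (simp add: dual_def rank_matroid_def)
qed

lemma matroid_dual: "matroid (dual M)"
  unfolding dual_eq_rank_matroid by (rule rank_function.matroid_rank_matroid[OF rank_function_dual_rank])

lemma rank_dual:
  "A \<subseteq> ground M \<Longrightarrow>
    int (rank (dual M) A) = int (card A) + int (rank M (ground M - A)) - int (rank M (ground M))"
  unfolding dual_eq_rank_matroid dual_rank_def[symmetric]
  by (rule rank_function.rank_rank_matroid[OF rank_function_dual_rank])

lemma ground_dual: "ground (dual M) = ground M"
  by (simp add: dual_def)

end

text \<open>For \<open>X\<close> disjoint from the ground set of \<open>N\<close> this is the direct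
  sum of \<open>N\<close> and the free matroid on \<open>X\<close>, truncated to the rank of
  \<open>N\<close>. It serves as a closed form of the iterated free extension in which no
  enumeration of \<open>X\<close> occurs.\<close>

definition free_sum :: "'a indep_system \<Rightarrow> 'a set \<Rightarrow> 'a indep_system" where
  "free_sum N X = \<lparr>ground = ground N \<union> X,
     indep = {I. I \<subseteq> ground N \<union> X \<and> I \<inter> ground N \<in> indep N \<and> card I \<le> rank N (ground N)}\<rparr>"

lemma ground_free_sum: "ground (free_sum N X) = ground N \<union> X"
  by (simp add: free_sum_def)

context matroid
begin

context
  fixes X assumes X: "finite X" "X \<inter> ground M = {}"
begin

lemma free_sum_indep_finite: "I \<in> indep (free_sum M X) \<Longrightarrow> finite I"
  using X(1) finite_ground by (auto simp: free_sum_def intro: finite_subset)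

lemma matroid_free_sum: "matroid (free_sum M X)"
proof
  show "finite (ground (free_sum M X))" using X(1) finite_ground by (simp add: free_sum_def)
  show "{} \<in> indep (free_sum M X)" using indep_empty by (simp add: free_sum_def)
  show "I \<subseteq> ground (free_sum M X)" if "I \<in> indep (free_sum M X)" for I
    using that by (simp add: free_sum_def)
  show "J \<in> indep (free_sum M X)" if I: "I \<in> indep (free_sum M X)" and J: "J \<subseteq> I" for I J
  proof -
    have "card J \<le> card I" using free_sum_indep_finite[OF I] J by (rule card_mono)
    moreover have "J \<inter> ground M \<in> indep M"
      by (rule indep_mono[of "I \<inter> ground M"]) (use I J in \<open>auto simp: free_sum_def\<close>)
    ultimately show ?thesis using I J by (auto simp: free_sum_def)
  qed
  show "\<exists>x \<in> J - I. insert x I \<in> indep (free_sum M X)"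
    if I: "I \<in> indep (free_sum M X)" and J: "J \<in> indep (free_sum M X)" and c: "card I < card J" for I J
  proof -
    have i: "I \<subseteq> ground M \<union> X" "I \<inter> ground M \<in> indep M" "J \<subseteq> ground M \<union> X" "J \<inter> ground M \<in> indep M"
      "card J \<le> rank M (ground M)" using I J by (simp_all add: free_sum_def)
    have fin: "finite I" "finite J" using I J free_sum_indep_finite by auto
    \<comment> \<open>An element of \<open>X\<close> can be added without touching the trace on
      \<open>ground M\<close>. If \<open>J\<close> offers none, its surplus over \<open>I\<close>
      lies inside \<open>ground M\<close>, where augmentation in \<open>M\<close> applies.\<close>
    have "\<exists>x \<in> J - I. insert x I \<inter> ground M \<in> indep M"
    proof (cases "J \<inter> X \<subseteq> I")
      case False
      then obtain x where "x \<in> J - I" "x \<in> X" by blast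
      moreover from this have "insert x I \<inter> ground M = I \<inter> ground M" using X(2) by blast
      ultimately show ?thesis using i(2) by (intro bexI[of _ x]) simp_all
    next
      case True
      have part: "card L = card (L \<inter> ground M) + card (L \<inter> X)"
        if "L \<subseteq> ground M \<union> X" "finite L" for L
      proof -
        have "L = (L \<inter> ground M) \<union> (L \<inter> X)" "(L \<inter> ground M) \<inter> (L \<inter> X) = {}"
          using that(1) X(2) by auto
        then show ?thesis using card_Un_disjoint[of "L \<inter> ground M" "L \<inter> X"] that(2) by simp
      qed
      have "card (J \<inter> X) \<le> card (I \<inter> X)" using True fin by (intro card_mono) auto
      then have "card (I \<inter> ground M) < card (J \<inter> ground M)"
        using part[OF i(1) fin(1)] part[OF i(3) fin(2)] c by simp
      then obtain x where "x \<in> J \<inter> ground M - I \<inter> ground M" "insert x (I \<inter> ground M) \<in> indep M"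
        using augmentation[OF i(2,4)] by blast
      then show ?thesis by (intro bexI[of _ x]) auto
    qed
    then obtain x where x: "x \<in> J - I" "insert x I \<inter> ground M \<in> indep M" by blast
    moreover have "card (insert x I) \<le> rank M (ground M)" using x(1) fin(1) c i(5) by simp
    moreover have "insert x I \<subseteq> ground M \<union> X" using x(1) i(1,3) by blast
    ultimately show ?thesis unfolding free_sum_def by auto
  qed
qed

lemma rank_free_sum:
  assumes A: "A \<subseteq> ground M \<union> X"
  shows "rank (free_sum M X) A = min (rank M (A \<inter> ground M) + card (A \<inter> X)) (rank M (ground M))"
    (is "_ = ?m")
proof (rule antisym)
  interpret F: matroid "free_sum M X" by (rule matroid_free_sum)
  obtain I where I: "I \<in> indep (free_sum M X)" "I \<subseteq> A" "card I = rank (free_sum M X) A"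
    by (rule F.rank_attained)
  have "card I = card (I \<inter> ground M \<union> I \<inter> X)"
    by (rule arg_cong[of _ _ card]) (use A I(2) in blast)
  also have "\<dots> \<le> card (I \<inter> ground M) + card (I \<inter> X)" by (rule card_Un_le)
  also have "card (I \<inter> ground M) \<le> rank M (A \<inter> ground M)"
    using I(1,2) by (intro indep_card_le_rank) (auto simp: free_sum_def)
  also have "card (I \<inter> X) \<le> card (A \<inter> X)" using X(1) I(2) by (intro card_mono) auto
  finally show "rank (free_sum M X) A \<le> ?m" using I(1,3) by (simp add: free_sum_def)
next
  interpret F: matroid "free_sum M X" by (rule matroid_free_sum)
  obtain J where J: "J \<in> indep M" "J \<subseteq> A \<inter> ground M" "card J = rank M (A \<inter> ground M)"
    by (rule rank_attained)
  have "card (J \<union> A \<inter> X) = card J + card (A \<inter> X)"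
    using indep_finite[OF J(1)] X J(2) by (intro card_Un_disjoint) auto
  then have "?m \<le> card (J \<union> A \<inter> X)" using J(3) by simp
  \<comment> \<open>The set \<open>J \<union> A \<inter> X\<close> may be too large for the
    truncation, so it is cut down to the permitted size.\<close>
  then obtain K where K: "K \<subseteq> J \<union> A \<inter> X" "card K = ?m"
    by (metis obtain_subset_with_card_n)
  have "K \<inter> ground M \<in> indep M" by (rule indep_mono[OF J(1)]) (use K(1) X(2) in blast)
  moreover have "K \<subseteq> ground M \<union> X" "K \<subseteq> A" using K(1) J(2) A by auto
  ultimately have "K \<in> indep (free_sum M X)" using K(2) by (simp add: free_sum_def)
  then show "?m \<le> rank (free_sum M X) A" using F.indep_card_le_rank[of K A] \<open>K \<subseteq> A\<close> K(2) by simp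
qed

end

lemma free_ext_eq_free_sum:
  assumes x: "x \<notin> ground M"
  shows "free_ext M x = free_sum M {x}"
proof -
  have indep_iff: "\<not> (\<exists>C \<in> circuits M. C \<subseteq> I) \<longleftrightarrow> I \<inter> ground M \<in> indep M" for I
  proof
    assume "\<not> (\<exists>C \<in> circuits M. C \<subseteq> I)"
    then show "I \<inter> ground M \<in> indep M" using dependent_contains_circuit[of "I \<inter> ground M"] by blast
  next
    assume I: "I \<inter> ground M \<in> indep M"
    show "\<not> (\<exists>C \<in> circuits M. C \<subseteq> I)"
    proof
      assume "\<exists>C \<in> circuits M. C \<subseteq> I"
      then obtain C where C: "C \<in> circuits M" "C \<subseteq> I" by blast
      then have "C \<subseteq> I \<inter> ground M" by (auto simp: circuits_def)
      then show False using indep_mono[OF I] C(1) by (auto simp: circuits_def)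
    qed
  qed
  \<comment> \<open>The independent trace has at most r(M) elements, so exceeding r(M) forces
    \<open>x \<in> I\<close> and makes the trace itself a basis. Avoiding the new circuits thus
    becomes a bound on the cardinality.\<close>
  have basis_in: "(\<exists>B. basis M B \<and> insert x B \<subseteq> I) \<longleftrightarrow> rank M (ground M) < card I"
    if I: "I \<subseteq> insert x (ground M)" "I \<inter> ground M \<in> indep M" for I
  proof -
    have finI: "finite I" using I(1) finite_ground by (meson finite_insert finite_subset)
    have le: "card (I \<inter> ground M) \<le> rank M (ground M)" by (rule indep_card_le_rank[OF I(2)]) simp
    show ?thesis
    proof
      assume "\<exists>B. basis M B \<and> insert x B \<subseteq> I"
      then obtain B where B: "basis M B" "insert x B \<subseteq> I" by blast
      then have "x \<notin> B" "finite B" "card B = rank M (ground M)"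
        using basis_iff x indep_subset indep_finite by auto
      then show "rank M (ground M) < card I" using card_mono[OF finI B(2)] by simp
    next
      assume c: "rank M (ground M) < card I"
      have "x \<in> I"
      proof (rule ccontr)
        assume "x \<notin> I"
        then have "I \<inter> ground M = I" using I(1) by blast
        then show False using c le by simp
      qed
      then have "I = insert x (I \<inter> ground M)" using I(1) by blast
      moreover from this have "card I = Suc (card (I \<inter> ground M))"
        using x finI by (metis IntE card_insert_disjoint finite_Int)
      ultimately have "basis M (I \<inter> ground M)" "insert x (I \<inter> ground M) \<subseteq> I"
        using c le I(2) basis_iff by auto
      then show "\<exists>B. basis M B \<and> insert x B \<subseteq> I" by blast
    qed
  qed
  have "\<not> (\<exists>C \<in> circuits M \<union> {insert x B |B. basis M B}. C \<subseteq> I) \<longleftrightarrow>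
      \<not> (\<exists>C \<in> circuits M. C \<subseteq> I) \<and> \<not> (\<exists>B. basis M B \<and> insert x B \<subseteq> I)" for I
    by blast
  then have "I \<subseteq> insert x (ground M) \<and> \<not> (\<exists>C \<in> circuits M \<union> {insert x B |B. basis M B}. C \<subseteq> I) \<longleftrightarrow>
      I \<subseteq> insert x (ground M) \<and> I \<inter> ground M \<in> indep M \<and> card I \<le> rank M (ground M)" for I
    using indep_iff[of I] basis_in[of I] by (meson not_less)
  then show ?thesis by (simp add: free_ext_def from_circuits_def free_sum_def)
qed

lemma free_sum_empty: "free_sum M {} = M"
proof -
  have "{I. I \<subseteq> ground M \<and> I \<inter> ground M \<in> indep M \<and> card I \<le> rank M (ground M)} = indep M"
    using indep_subset indep_card_le_rank by (auto simp: Int_absorb2)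
  then show ?thesis by (simp add: free_sum_def)
qed

text \<open>Adding \<open>X\<close> does not change the rank, so both truncations use the same bound
  and the outer one implies the inner one.\<close>

lemma free_sum_free_sum:
  assumes X: "finite X" "X \<inter> ground M = {}" and Y: "finite Y" "Y \<inter> (ground M \<union> X) = {}"
  shows "free_sum (free_sum M X) Y = free_sum M (X \<union> Y)"
proof -
  have "rank (free_sum M X) (ground M \<union> X) = rank M (ground M)"
    using rank_free_sum[OF X, of "ground M \<union> X"] X(2) by (simp add: Int_Un_distrib2 Int_commute)
  moreover have "card (I \<inter> (ground M \<union> X)) \<le> card I" if "I \<subseteq> ground M \<union> X \<union> Y" for I
    using that X(1) Y(1) finite_ground by (intro card_mono) (auto intro: finite_subset)
  moreover have "I \<inter> (ground M \<union> X) \<inter> ground M = I \<inter> ground M" for I by blast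
  ultimately have "indep (free_sum (free_sum M X) Y) = indep (free_sum M (X \<union> Y))"
    by (auto simp: free_sum_def Un_assoc intro: order_trans)
  then show ?thesis by (simp add: free_sum_def Un_assoc)
qed

end

lemma foldl_free_ext:
  assumes "matroid N" "distinct xs" "set xs \<inter> ground N = {}"
  shows "foldl free_ext N xs = free_sum N (set xs)"
  using assms
proof (induction xs arbitrary: N)
  case Nil
  then show ?case by (simp add: matroid.free_sum_empty)
next
  case (Cons x xs)
  interpret N: matroid N by fact
  have x: "x \<notin> ground N" using Cons.prems(3) by simp
  then have "matroid (free_sum N {x})" by (intro N.matroid_free_sum) auto
  then have "foldl free_ext (free_sum N {x}) xs = free_sum (free_sum N {x}) (set xs)"
    using Cons.prems by (intro Cons.IH) (auto simp: ground_free_sum)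
  also have "\<dots> = free_sum N ({x} \<union> set xs)"
    using Cons.prems by (intro N.free_sum_free_sum) auto
  finally show ?case using N.free_ext_eq_free_sum[OF x] by simp
qed

text \<open>The enumeration chosen by \<open>SOME\<close> enters the result only through its set of
  elements, which makes the choice harmless.\<close>

lemma free_extension_eq_free_sum:
  assumes "matroid N" "finite X" "X \<inter> ground N = {}"
  shows "free_extension N X = free_sum N X"
proof -
  have "\<exists>xs. distinct xs \<and> set xs = X" using finite_distinct_list[OF assms(2)] by blast
  then have "distinct (SOME xs. distinct xs \<and> set xs = X) \<and> set (SOME xs. distinct xs \<and> set xs = X) = X"
    by (rule someI_ex)
  then show ?thesis
    unfolding free_extension_def using foldl_free_ext[OF assms(1)] assms(3) by metis
qed

text \<open>A set \<open>I\<close> is independent here iff its complement spans N* + X, that is,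
  r*(S - I) + |X - I| \<ge> r*(S), where N* is the dual of \<open>M\<close> and S its ground set. By
  the formula for dual ranks, r*(S) - r*(S - I) is the nullity of I \<inter> S.\<close>

lemma (in matroid) free_coextension_eq:
  assumes X: "finite X" "X \<inter> ground M = {}"
  shows "free_coextension M X = \<lparr>ground = ground M \<union> X,
    indep = {I. I \<subseteq> ground M \<union> X \<and> nullity M (I \<inter> ground M) \<le> int (card (X - I))}\<rparr>"
proof -
  let ?S = "ground M"
  interpret D: matroid "dual M" by (rule matroid_dual)
  have X': "X \<inter> ground (dual M) = {}" using X(2) by (simp add: ground_dual)
  interpret F: matroid "free_sum (dual M) X" by (rule D.matroid_free_sum[OF X(1) X'])
  have gF: "ground (free_sum (dual M) X) = ?S \<union> X" by (simp add: ground_free_sum ground_dual)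
  have co: "free_coextension M X = dual (free_sum (dual M) X)"
    unfolding free_coextension_def by (simp add: free_extension_eq_free_sum[OF matroid_dual X(1) X'])
  have "I \<in> indep (dual (free_sum (dual M) X)) \<longleftrightarrow> nullity M (I \<inter> ?S) \<le> int (card (X - I))"
    if I: "I \<subseteq> ?S \<union> X" for I
  proof -
    have eqs: "(?S \<union> X - I) \<inter> ?S = ?S - I" "(?S \<union> X - I) \<inter> X = X - I" "?S - (?S - I) = I \<inter> ?S"
      "(?S \<union> X) \<inter> ?S = ?S" "(?S \<union> X) \<inter> X = X" by auto
    have r: "rank (free_sum (dual M) X) (?S \<union> X - I)
        = min (rank (dual M) (?S - I) + card (X - I)) (rank (dual M) ?S)"
      "rank (free_sum (dual M) X) (?S \<union> X) = rank (dual M) ?S"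
      using D.rank_free_sum[OF X(1) X', of "?S \<union> X - I"] D.rank_free_sum[OF X(1) X', of "?S \<union> X"] eqs
      by (simp_all add: ground_dual)
    have "int (rank (dual M) (?S - I)) = int (card (?S - I)) + int (rank M (I \<inter> ?S)) - int (rank M ?S)"
      "int (rank (dual M) ?S) = int (card ?S) - int (rank M ?S)"
      using rank_dual[of "?S - I"] rank_dual[of ?S] eqs rank_empty by simp_all
    moreover have "card ?S = card (?S - I) + card (I \<inter> ?S)"
      using finite_ground by (metis Int_commute add.commute card_Int_Diff)
    moreover have "I \<in> indep (dual (free_sum (dual M) X)) \<longleftrightarrow>
        rank (dual M) ?S \<le> rank (dual M) (?S - I) + card (X - I)"
      using I r by (auto simp: F.dual_indep_iff gF min_def)
    ultimately show ?thesis unfolding nullity_def by linarith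
  qed
  moreover have "I \<subseteq> ?S \<union> X" if "I \<in> indep (dual (free_sum (dual M) X))" for I
    using that F.dual_indep_iff gF by simp
  ultimately have "indep (free_coextension M X)
      = {I. I \<subseteq> ?S \<union> X \<and> nullity M (I \<inter> ?S) \<le> int (card (X - I))}"
    unfolding co by blast
  moreover have "ground (free_coextension M X) = ?S \<union> X" unfolding co by (simp add: F.ground_dual gF)
  ultimately show ?thesis by simp
qed

section \<open>The prescribed cyclic flats\<close>

lemma (in matroid) rank_Diff_not_coloop:
  assumes "e \<in> ground M" "\<not> coloop M e"
  shows "rank M (ground M - {e}) = rank M (ground M)"
proof -
  obtain B where B: "basis M B" "e \<notin> B" using assms by (auto simp: coloop_def)
  then have "B \<in> indep M" "card B = rank M (ground M)" using basis_iff by auto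
  moreover from this have "B \<subseteq> ground M - {e}" using B(2) indep_subset by blast
  ultimately have "rank M (ground M) \<le> rank M (ground M - {e})" using indep_card_le_rank by metis
  then show ?thesis using rank_mono[of "ground M - {e}" "ground M"] by auto
qed

lemma (in matroid) nullity_nonneg: "A \<subseteq> ground M \<Longrightarrow> 0 \<le> nullity M A"
  using rank_le_card[of A] finite_ground finite_subset by (auto simp: nullity_def)

text \<open>With \<open>rank_via_cyclic_flat\<close>, the nullity of \<open>A\<close> is the largest
  value of |A \<inter> W| - r(W) over cyclic flats W; this bound for arbitrary \<open>W\<close> is
  the half needed to control how the sets \<open>S\<^sub>1'\<close> and \<open>S\<^sub>2'\<close>
  meet flats.\<close>

lemma (in matroid) nullity_le_card_Int:
  assumes "A \<subseteq> ground M"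
  shows "int (card (A \<inter> W)) - int (rank M W) \<le> nullity M A"
proof -
  have fin: "finite A" using assms finite_ground finite_subset by blast
  have "card A = card (A \<inter> W) + card (A - W)" using fin by (metis card_Int_Diff)
  then show ?thesis using rank_le_diff[OF fin, of W] unfolding nullity_def by linarith
qed

locale free_amalgam =
  fixes M\<^sub>1 M\<^sub>2 :: "'a indep_system" and S\<^sub>1 S\<^sub>2 S\<^sub>1' S\<^sub>2' T\<^sub>1 T\<^sub>2 E :: "'a set"
    and k :: int and \<Z> :: "'a set set" and r :: "'a set \<Rightarrow> int"
  assumes matroid_M1: "matroid M\<^sub>1" and matroid_M2: "matroid M\<^sub>2"
    and ground_M1: "ground M\<^sub>1 = S\<^sub>1" and ground_M2: "ground M\<^sub>2 = S\<^sub>2" and disjoint_S: "S\<^sub>1 \<inter> S\<^sub>2 = {}"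
    and rank_pos1: "0 < rank M\<^sub>1 S\<^sub>1" and rank_pos2: "0 < rank M\<^sub>2 S\<^sub>2"
    and sub1: "S\<^sub>1' \<subseteq> S\<^sub>1" and sub2: "S\<^sub>2' \<subseteq> S\<^sub>2"
    and k_ge: "k \<ge> int (rank M\<^sub>1 S\<^sub>1) + nullity M\<^sub>1 S\<^sub>1' + int (rank M\<^sub>2 S\<^sub>2) + nullity M\<^sub>2 S\<^sub>2'"
    and finite_T1: "finite T\<^sub>1" and finite_T2: "finite T\<^sub>2"
    and card_T1: "int (card T\<^sub>1) = k - int (rank M\<^sub>1 S\<^sub>1) - int (card S\<^sub>2')"
    and card_T2: "int (card T\<^sub>2) = k - int (rank M\<^sub>2 S\<^sub>2) - int (card S\<^sub>1')"
    and disjoint_T: "T\<^sub>1 \<inter> T\<^sub>2 = {}" "T\<^sub>1 \<inter> (S\<^sub>1 \<union> S\<^sub>2) = {}" "T\<^sub>2 \<inter> (S\<^sub>1 \<union> S\<^sub>2) = {}"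
    and E_eq: "E = S\<^sub>1 \<union> S\<^sub>2 \<union> T\<^sub>1 \<union> T\<^sub>2"
    and Z_eq: "\<Z> = {{}, E} \<union> {F \<union> T\<^sub>1 \<union> S\<^sub>2' | F. F \<in> proper_cyclic_flats M\<^sub>1}
                   \<union> {F \<union> T\<^sub>2 \<union> S\<^sub>1' | F. F \<in> proper_cyclic_flats M\<^sub>2}"
    and r_empty: "r {} = 0" and r_E: "r E = k"
    and r_1: "\<And>F. F \<in> proper_cyclic_flats M\<^sub>1 \<Longrightarrow>
           r (F \<union> T\<^sub>1 \<union> S\<^sub>2') = int (rank M\<^sub>1 F) + int (card T\<^sub>1) + int (card S\<^sub>2')"
    and r_2: "\<And>F. F \<in> proper_cyclic_flats M\<^sub>2 \<Longrightarrow>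
           r (F \<union> T\<^sub>2 \<union> S\<^sub>1') = int (rank M\<^sub>2 F) + int (card T\<^sub>2) + int (card S\<^sub>1')"
    and no_coloop1: "T\<^sub>2 = {} \<Longrightarrow> S\<^sub>2' = S\<^sub>2 \<Longrightarrow> \<not> (\<exists>e. coloop M\<^sub>1 e)"
    and no_coloop2: "T\<^sub>1 = {} \<Longrightarrow> S\<^sub>1' = S\<^sub>1 \<Longrightarrow> \<not> (\<exists>e. coloop M\<^sub>2 e)"
begin

sublocale M\<^sub>1: matroid M\<^sub>1 by (rule matroid_M1)

sublocale M\<^sub>2: matroid M\<^sub>2 by (rule matroid_M2)

text \<open>The situation is symmetric in the two indices. Facts are proved for lifts from the first
  matroid and transported to the second by interpreting the locale along this lemma.\<close>

lemma swap: "free_amalgam M\<^sub>2 M\<^sub>1 S\<^sub>2 S\<^sub>1 S\<^sub>2' S\<^sub>1' T\<^sub>2 T\<^sub>1 E k \<Z> r"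
proof
  show "\<Z> = {{}, E} \<union> {F \<union> T\<^sub>2 \<union> S\<^sub>1' | F. F \<in> proper_cyclic_flats M\<^sub>2}
                   \<union> {F \<union> T\<^sub>1 \<union> S\<^sub>2' | F. F \<in> proper_cyclic_flats M\<^sub>1}"
    unfolding Z_eq by blast
qed (use matroid_M1 matroid_M2 ground_M1 ground_M2 disjoint_S rank_pos1 rank_pos2 sub1 sub2 k_ge
    finite_T1 finite_T2 card_T1 card_T2 disjoint_T E_eq r_empty r_E r_1 r_2 no_coloop1 no_coloop2
    in \<open>auto simp: Int_commute Un_ac\<close>)

abbreviation X\<^sub>1 :: "'a set" where "X\<^sub>1 \<equiv> T\<^sub>1 \<union> S\<^sub>2'"

abbreviation X\<^sub>2 :: "'a set" where "X\<^sub>2 \<equiv> T\<^sub>2 \<union> S\<^sub>1'"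

lemma finite_S: "finite S\<^sub>1" "finite S\<^sub>2"
  using M\<^sub>1.finite_ground M\<^sub>2.finite_ground ground_M1 ground_M2 by auto

lemma finite_sub: "finite S\<^sub>1'" "finite S\<^sub>2'"
  using finite_S sub1 sub2 finite_subset by blast+

lemma nullities_nonneg: "0 \<le> nullity M\<^sub>1 S\<^sub>1'" "0 \<le> nullity M\<^sub>2 S\<^sub>2'"
  using M\<^sub>1.nullity_nonneg M\<^sub>2.nullity_nonneg sub1 sub2 ground_M1 ground_M2 by auto

lemma X1_disjoint: "X\<^sub>1 \<inter> S\<^sub>1 = {}" "X\<^sub>1 \<inter> X\<^sub>2 = {}"
  using disjoint_T disjoint_S sub1 sub2 by auto

lemma finite_X1: "finite X\<^sub>1"
  using finite_T1 finite_sub by simp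

lemma card_X1': "card X\<^sub>1 = card T\<^sub>1 + card S\<^sub>2'"
  using disjoint_T sub2 finite_T1 finite_sub by (intro card_Un_disjoint) auto

lemma card_X1: "int (card X\<^sub>1) = k - int (rank M\<^sub>1 S\<^sub>1)"
  using card_X1' card_T1 by simp

lemma card_Un_X1: "A \<subseteq> S\<^sub>1 \<Longrightarrow> B \<subseteq> X\<^sub>1 \<Longrightarrow> card (A \<union> B) = card A + card B"
  using finite_S finite_X1 X1_disjoint by (intro card_Un_disjoint) (auto intro: finite_subset)

lemma card_Int_S1': "int (card (A \<inter> S\<^sub>1')) \<le> int (rank M\<^sub>1 A) + nullity M\<^sub>1 S\<^sub>1'"
  using M\<^sub>1.nullity_le_card_Int[of S\<^sub>1' A] sub1 ground_M1 by (simp add: Int_commute)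

lemma card_S1'_le: "int (card S\<^sub>1') \<le> int (rank M\<^sub>1 S\<^sub>1) + nullity M\<^sub>1 S\<^sub>1'"
  using card_Int_S1'[of S\<^sub>1] sub1 by (simp add: Int_absorb1)

lemma card_S2'_le: "int (card S\<^sub>2') \<le> int (rank M\<^sub>2 S\<^sub>2) + nullity M\<^sub>2 S\<^sub>2'"
  using free_amalgam.card_S1'_le[OF swap] .

lemma flat1:
  assumes "F \<in> proper_cyclic_flats M\<^sub>1"
  shows "F \<in> cyclic_flats M\<^sub>1" "F \<noteq> {}" "F \<subset> S\<^sub>1" "rank M\<^sub>1 F < rank M\<^sub>1 S\<^sub>1" "rank M\<^sub>1 F < card F"
  using assms M\<^sub>1.proper_flat_rank[OF assms] M\<^sub>1.cyclic_nullity_pos[of F] ground_M1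
  by (auto simp: proper_cyclic_flats_def cyclic_flats_def)

lemma r_lift1: "F \<in> proper_cyclic_flats M\<^sub>1 \<Longrightarrow> r (F \<union> X\<^sub>1) = int (rank M\<^sub>1 F) + int (card X\<^sub>1)"
  using r_1[of F] card_X1' by (simp add: Un_assoc)

lemma Z_cases:
  assumes "W \<in> \<Z>"
  obtains "W = {}" | "W = E"
    | F where "F \<in> proper_cyclic_flats M\<^sub>1" "W = F \<union> X\<^sub>1"
    | G where "G \<in> proper_cyclic_flats M\<^sub>2" "W = G \<union> X\<^sub>2"
  using assms unfolding Z_eq Un_assoc by blast

lemma in_Z: "{} \<in> \<Z>" "E \<in> \<Z>" "F \<in> proper_cyclic_flats M\<^sub>1 \<Longrightarrow> F \<union> X\<^sub>1 \<in> \<Z>"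
  unfolding Z_eq Un_assoc by blast+

lemma lift1_subset_iff:
  assumes "F \<subseteq> S\<^sub>1" shows "F \<union> X\<^sub>1 \<subseteq> G \<union> X\<^sub>1 \<longleftrightarrow> F \<subseteq> G"
  using assms X1_disjoint by blast

text \<open>Containment forces \<open>T\<^sub>1 = {}\<close> and
  \<open>F \<subseteq> S\<^sub>1'\<close>. The first gives |S'_2| = k - r(M_1), and the bound on
  \<open>k\<close> together with \<open>card_S2'_le\<close> then leaves nullity zero for
  \<open>S\<^sub>1'\<close>. But \<open>F\<close> is a nonempty cyclic set, hence dependent.\<close>

lemma lift1_not_subset_lift2:
  assumes F: "F \<in> proper_cyclic_flats M\<^sub>1" and G: "G \<in> proper_cyclic_flats M\<^sub>2"
  shows "\<not> F \<union> X\<^sub>1 \<subseteq> G \<union> X\<^sub>2"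
proof
  assume sub: "F \<union> X\<^sub>1 \<subseteq> G \<union> X\<^sub>2"
  have G2: "G \<subseteq> S\<^sub>2" using free_amalgam.flat1(3)[OF swap G] by blast
  have "T\<^sub>1 = {}" using sub G2 disjoint_T sub1 by blast
  moreover have "F \<subseteq> S\<^sub>1'" using sub flat1(3)[OF F] G2 disjoint_T disjoint_S by blast
  ultimately have "int (card F) \<le> int (rank M\<^sub>1 F) + nullity M\<^sub>1 S\<^sub>1'" "int (card S\<^sub>2') = k - int (rank M\<^sub>1 S\<^sub>1)"
    using card_Int_S1'[of F] card_T1 by (simp_all add: Int_absorb2)
  then show False using flat1(5)[OF F] k_ge card_S2'_le by linarith
qed

lemma lift1_subset_E: "F \<subseteq> S\<^sub>1 \<Longrightarrow> F \<union> X\<^sub>1 \<subseteq> E"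
  using E_eq sub2 by blast

lemma E_not_subset_lift1: "F \<in> proper_cyclic_flats M\<^sub>1 \<Longrightarrow> \<not> E \<subseteq> F \<union> X\<^sub>1"
  using flat1(3)[of F] X1_disjoint E_eq by blast

section \<open>Rank gaps at the two ends of the prescribed family\<close>

lemma lift1_gap_top:
  assumes F: "F \<in> proper_cyclic_flats M\<^sub>1"
  shows "r (F \<union> X\<^sub>1) < r E" "r E - r (F \<union> X\<^sub>1) < int (card (E - (F \<union> X\<^sub>1)))"
proof -
  have r: "r E - r (F \<union> X\<^sub>1) = int (rank M\<^sub>1 S\<^sub>1) - int (rank M\<^sub>1 F)"
    using r_lift1[OF F] card_X1 r_E by simp
  then show "r (F \<union> X\<^sub>1) < r E" using flat1(4)[OF F] by simp
  have finE: "finite E" using E_eq finite_S finite_T1 finite_T2 by simp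
  have sub: "S\<^sub>1 - F \<subseteq> E - (F \<union> X\<^sub>1)" using E_eq X1_disjoint by blast
  \<comment> \<open>The set \<open>E - (F \<union> X\<^sub>1)\<close> consists of
    \<open>S\<^sub>1 - F\<close>, \<open>T\<^sub>2\<close> and
    \<open>S\<^sub>2 - S\<^sub>2'\<close>. The first piece alone gives only the weak inequality.
    Strictness comes from the other two if they are not both empty, and otherwise from a non-coloop
    outside \<open>F\<close>, which can be deleted without loss of rank.\<close>
  have "rank M\<^sub>1 S\<^sub>1 < rank M\<^sub>1 F + card (E - (F \<union> X\<^sub>1))"
  proof (cases "T\<^sub>2 = {} \<and> S\<^sub>2' = S\<^sub>2")
    case True
    obtain x where x: "x \<in> S\<^sub>1" "x \<notin> F" using flat1(3)[OF F] by blast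
    then have "rank M\<^sub>1 S\<^sub>1 = rank M\<^sub>1 (S\<^sub>1 - {x})"
      using M\<^sub>1.rank_Diff_not_coloop[of x] no_coloop1 True ground_M1 by simp
    also have "\<dots> \<le> rank M\<^sub>1 F + card (S\<^sub>1 - {x} - F)"
      using finite_S by (intro M\<^sub>1.rank_le_diff) simp
    also have "card (S\<^sub>1 - {x} - F) < card (E - (F \<union> X\<^sub>1))"
      using finE sub x by (intro psubset_card_mono) auto
    finally show ?thesis by simp
  next
    case False
    have "S\<^sub>1 - F \<noteq> E - (F \<union> X\<^sub>1)"
      using False E_eq flat1(3)[OF F] disjoint_T disjoint_S sub2 by blast
    then have "card (S\<^sub>1 - F) < card (E - (F \<union> X\<^sub>1))"
      using finE sub by (intro psubset_card_mono) auto
    then show ?thesis using M\<^sub>1.rank_le_diff[OF finite_S(1), of F] by simp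
  qed
  then show "r E - r (F \<union> X\<^sub>1) < int (card (E - (F \<union> X\<^sub>1)))" using r by simp
qed

lemma lift1_gap_bottom:
  assumes F: "F \<in> proper_cyclic_flats M\<^sub>1"
  shows "0 < r (F \<union> X\<^sub>1)" "r (F \<union> X\<^sub>1) < int (card (F \<union> X\<^sub>1))"
proof -
  have "card (F \<union> X\<^sub>1) = card F + card X\<^sub>1" using flat1(3)[OF F] by (intro card_Un_X1) auto
  \<comment> \<open>\<open>F\<close> may consist of loops and have rank zero, so the lift owes its
    positive rank to \<open>X\<^sub>1\<close>, which has at least r(M_2) elements.\<close>
  moreover have "0 < card X\<^sub>1" using card_X1 k_ge rank_pos2 nullities_nonneg by linarith
  ultimately show "0 < r (F \<union> X\<^sub>1)" "r (F \<union> X\<^sub>1) < int (card (F \<union> X\<^sub>1))"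
    using r_lift1[OF F] flat1(5)[OF F] by simp_all
qed

text \<open>Counting \<open>E\<close> through the disjoint sets \<open>X\<^sub>1\<close>,
  \<open>X\<^sub>2\<close> and what they leave uncovered gives |E| - k as a sum of nonnegative
  terms. If all of them vanish, then \<open>S\<^sub>1' = S\<^sub>1\<close>,
  \<open>S\<^sub>2' = S\<^sub>2\<close>, \<open>T\<^sub>2 = {}\<close> and M_1 is a free matroid of
  positive rank, all of whose elements are coloops.\<close>

lemma gap_bottom_top: "0 < k" "k < int (card E)"
proof -
  show "0 < k" using k_ge rank_pos1 nullities_nonneg by linarith
  have "E = ((S\<^sub>1 - S\<^sub>1') \<union> (S\<^sub>2 - S\<^sub>2')) \<union> (X\<^sub>1 \<union> X\<^sub>2)" using E_eq sub1 sub2 by blast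
  moreover have "((S\<^sub>1 - S\<^sub>1') \<union> (S\<^sub>2 - S\<^sub>2')) \<inter> (X\<^sub>1 \<union> X\<^sub>2) = {}" "(S\<^sub>1 - S\<^sub>1') \<inter> (S\<^sub>2 - S\<^sub>2') = {}"
    using disjoint_S disjoint_T sub1 sub2 by auto
  ultimately have "card E = card (S\<^sub>1 - S\<^sub>1') + card (S\<^sub>2 - S\<^sub>2') + (card X\<^sub>1 + card X\<^sub>2)"
    using finite_S finite_X1 free_amalgam.finite_X1[OF swap] X1_disjoint(2)
    by (simp add: card_Un_disjoint)
  then have cE: "int (card E) = int (card (S\<^sub>1 - S\<^sub>1')) + int (card (S\<^sub>2 - S\<^sub>2'))
      + 2 * k - int (rank M\<^sub>1 S\<^sub>1) - int (rank M\<^sub>2 S\<^sub>2)"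
    using card_X1 free_amalgam.card_X1[OF swap] by simp
  show "k < int (card E)"
  proof (rule ccontr)
    assume "\<not> ?thesis"
    then have z: "card (S\<^sub>1 - S\<^sub>1') = 0" "card (S\<^sub>2 - S\<^sub>2') = 0" "nullity M\<^sub>1 S\<^sub>1' = 0" "nullity M\<^sub>2 S\<^sub>2' = 0"
      "k = int (rank M\<^sub>1 S\<^sub>1) + int (rank M\<^sub>2 S\<^sub>2)"
      using cE k_ge nullities_nonneg by linarith+
    then have eq: "S\<^sub>1' = S\<^sub>1" "S\<^sub>2' = S\<^sub>2" using finite_S sub1 sub2 by auto
    then have "T\<^sub>2 = {}" using card_T2 z(3,5) finite_T2 by (simp add: nullity_def)
    then have nc: "\<not> (\<exists>e. coloop M\<^sub>1 e)" using no_coloop1 eq by simp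
    obtain x where x: "x \<in> S\<^sub>1" using rank_pos1 M\<^sub>1.rank_empty by fastforce
    then have "rank M\<^sub>1 (S\<^sub>1 - {x}) = rank M\<^sub>1 S\<^sub>1"
      using M\<^sub>1.rank_Diff_not_coloop[of x] nc ground_M1 by simp
    moreover have "rank M\<^sub>1 S\<^sub>1 = card S\<^sub>1" using z(3) eq by (simp add: nullity_def)
    moreover have "rank M\<^sub>1 (S\<^sub>1 - {x}) \<le> card (S\<^sub>1 - {x})" using finite_S by (intro M\<^sub>1.rank_le_card) simp
    moreover have "card (S\<^sub>1 - {x}) < card S\<^sub>1" using x finite_S by (intro card_Diff1_less) auto
    ultimately show False by simp
  qed
qed

section \<open>Joins and meets in the prescribed family\<close>

lemma lift1_join_meet:
  assumes F: "F \<in> proper_cyclic_flats M\<^sub>1" and G: "G \<in> proper_cyclic_flats M\<^sub>1"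
  shows "\<exists>J \<in> \<Z>. \<exists>K \<in> \<Z>. (F \<union> X\<^sub>1) \<union> (G \<union> X\<^sub>1) \<subseteq> J
    \<and> (\<forall>W \<in> \<Z>. (F \<union> X\<^sub>1) \<union> (G \<union> X\<^sub>1) \<subseteq> W \<longrightarrow> J \<subseteq> W)
    \<and> K \<subseteq> (F \<union> X\<^sub>1) \<inter> (G \<union> X\<^sub>1) \<and> (\<forall>W \<in> \<Z>. W \<subseteq> (F \<union> X\<^sub>1) \<inter> (G \<union> X\<^sub>1) \<longrightarrow> W \<subseteq> K)
    \<and> r J + r K + int (card ((F \<union> X\<^sub>1) \<inter> (G \<union> X\<^sub>1) - K)) \<le> r (F \<union> X\<^sub>1) + r (G \<union> X\<^sub>1)"
proof -
  obtain J\<^sub>0 where J: "J\<^sub>0 \<in> cyclic_flats M\<^sub>1" "F \<union> G \<subseteq> J\<^sub>0" "rank M\<^sub>1 J\<^sub>0 = rank M\<^sub>1 (F \<union> G)"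
    "\<forall>W \<in> cyclic_flats M\<^sub>1. F \<union> G \<subseteq> W \<longrightarrow> J\<^sub>0 \<subseteq> W"
    using M\<^sub>1.cyclic_flats_join[OF flat1(1)[OF F] flat1(1)[OF G]] by auto
  obtain K\<^sub>0 where K: "K\<^sub>0 \<in> cyclic_flats M\<^sub>1" "K\<^sub>0 \<subseteq> F \<inter> G"
    "rank M\<^sub>1 (F \<inter> G) = rank M\<^sub>1 K\<^sub>0 + card (F \<inter> G - K\<^sub>0)"
    "\<forall>W \<in> cyclic_flats M\<^sub>1. W \<subseteq> F \<inter> G \<longrightarrow> W \<subseteq> K\<^sub>0"
    using M\<^sub>1.cyclic_flats_meet[OF flat1(1)[OF F] flat1(1)[OF G]] by auto
  have FS: "F \<subset> S\<^sub>1" "G \<subset> S\<^sub>1" "F \<noteq> {}" using F G flat1 by auto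
  have JS: "J\<^sub>0 \<subseteq> S\<^sub>1" using J(1) ground_M1 by (auto simp: cyclic_flats_def flat_def)
  have KS: "K\<^sub>0 \<subset> S\<^sub>1" using K(2) FS by blast
  have JP: "J\<^sub>0 \<noteq> S\<^sub>1 \<Longrightarrow> J\<^sub>0 \<in> proper_cyclic_flats M\<^sub>1"
    using J(1,2) FS ground_M1 by (auto simp: proper_cyclic_flats_def)
  have KP: "K\<^sub>0 \<noteq> {} \<Longrightarrow> K\<^sub>0 \<in> proper_cyclic_flats M\<^sub>1"
    using K(1) KS ground_M1 by (auto simp: proper_cyclic_flats_def)
  \<comment> \<open>Join and meet are those of M_1, lifted, except that the ends
    \<open>S\<^sub>1\<close> and {} are represented by \<open>E\<close> and {}. Lifts from M_2
    cannot interfere as bounds, because lifts from different matroids are incomparable.\<close>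
  define J where "J = (if J\<^sub>0 = S\<^sub>1 then E else J\<^sub>0 \<union> X\<^sub>1)"
  define K where "K = (if K\<^sub>0 = {} then {} else K\<^sub>0 \<union> X\<^sub>1)"
  have "J \<in> \<Z>" "K \<in> \<Z>" using in_Z JP KP by (auto simp: J_def K_def)
  moreover have "F \<union> X\<^sub>1 \<union> (G \<union> X\<^sub>1) \<subseteq> J"
    using J(2) lift1_subset_E[of F] lift1_subset_E[of G] FS by (auto simp: J_def)
  moreover have "J \<subseteq> W" if W: "W \<in> \<Z>" "F \<union> X\<^sub>1 \<union> (G \<union> X\<^sub>1) \<subseteq> W" for W
    using W(1)
  proof (cases rule: Z_cases)
    case 1
    then show ?thesis using W(2) FS by blast
  next
    case 2
    then show ?thesis using lift1_subset_E[OF JS] by (simp add: J_def)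
  next
    case (3 H)
    then have "F \<union> G \<subseteq> H" using W(2) FS X1_disjoint(1) by blast
    then have "J\<^sub>0 \<subseteq> H" using J(4) flat1(1)[OF 3(1)] by blast
    moreover from this have "J\<^sub>0 \<noteq> S\<^sub>1" using flat1(3)[OF 3(1)] by blast
    ultimately show ?thesis using 3(2) by (auto simp: J_def)
  next
    case (4 H)
    then show ?thesis using lift1_not_subset_lift2[OF F 4(1)] W(2) by blast
  qed
  moreover have "K \<subseteq> (F \<union> X\<^sub>1) \<inter> (G \<union> X\<^sub>1)" using K(2) by (auto simp: K_def)
  moreover have "W \<subseteq> K" if W: "W \<in> \<Z>" "W \<subseteq> (F \<union> X\<^sub>1) \<inter> (G \<union> X\<^sub>1)" for W
    using W(1)
  proof (cases rule: Z_cases)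
    case 1
    then show ?thesis by simp
  next
    case 2
    then show ?thesis using W(2) E_not_subset_lift1[OF F] by blast
  next
    case (3 H)
    have HS: "H \<subset> S\<^sub>1" "H \<noteq> {}" using flat1[OF 3(1)] by auto
    have "H \<subseteq> F \<inter> G" using W(2) 3(2) HS(1) X1_disjoint(1) by blast
    then have "H \<subseteq> K\<^sub>0" using K(4) flat1(1)[OF 3(1)] by blast
    then show ?thesis using 3(2) HS(2) by (auto simp: K_def)
  next
    case (4 H)
    then show ?thesis using free_amalgam.lift1_not_subset_lift2[OF swap 4(1) F] W(2) by blast
  qed
  moreover have "r J + r K + int (card ((F \<union> X\<^sub>1) \<inter> (G \<union> X\<^sub>1) - K)) \<le> r (F \<union> X\<^sub>1) + r (G \<union> X\<^sub>1)"
  proof -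
    have rJ: "r J = int (rank M\<^sub>1 J\<^sub>0) + int (card X\<^sub>1)"
      using r_lift1[OF JP] r_E card_X1 by (auto simp: J_def)
    \<comment> \<open>If the meet is {}, then |X_1| is missing from \<open>r K\<close>, but
      \<open>X\<^sub>1\<close> is now part of the set being counted. The sum is the same in both
      cases.\<close>
    have rK: "r K + int (card ((F \<union> X\<^sub>1) \<inter> (G \<union> X\<^sub>1) - K))
        = int (rank M\<^sub>1 K\<^sub>0) + int (card X\<^sub>1) + int (card (F \<inter> G - K\<^sub>0))"
    proof (cases "K\<^sub>0 = {}")
      case True
      have "(F \<union> X\<^sub>1) \<inter> (G \<union> X\<^sub>1) - K = (F \<inter> G) \<union> X\<^sub>1" using True by (auto simp: K_def)
      moreover have "card ((F \<inter> G) \<union> X\<^sub>1) = card (F \<inter> G) + card X\<^sub>1"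
        using FS by (intro card_Un_X1) auto
      ultimately show ?thesis using True r_empty M\<^sub>1.rank_empty by (simp add: K_def)
    next
      case False
      have "(F \<union> X\<^sub>1) \<inter> (G \<union> X\<^sub>1) - K = F \<inter> G - K\<^sub>0"
        using False X1_disjoint(1) FS by (auto simp: K_def)
      then show ?thesis using False r_lift1[OF KP[OF False]] by (simp add: K_def)
    qed
    show ?thesis
      using rJ rK r_lift1[OF F] r_lift1[OF G] J(3) K(3) M\<^sub>1.rank_submodular[of F G] by linarith
  qed
  ultimately show ?thesis by (intro bexI[of _ J] bexI[of _ K]) simp_all
qed

lemma cross_join_meet:
  assumes F: "F \<in> proper_cyclic_flats M\<^sub>1" and G: "G \<in> proper_cyclic_flats M\<^sub>2"
  shows "\<exists>J \<in> \<Z>. \<exists>K \<in> \<Z>. (F \<union> X\<^sub>1) \<union> (G \<union> X\<^sub>2) \<subseteq> J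
    \<and> (\<forall>W \<in> \<Z>. (F \<union> X\<^sub>1) \<union> (G \<union> X\<^sub>2) \<subseteq> W \<longrightarrow> J \<subseteq> W)
    \<and> K \<subseteq> (F \<union> X\<^sub>1) \<inter> (G \<union> X\<^sub>2) \<and> (\<forall>W \<in> \<Z>. W \<subseteq> (F \<union> X\<^sub>1) \<inter> (G \<union> X\<^sub>2) \<longrightarrow> W \<subseteq> K)
    \<and> r J + r K + int (card ((F \<union> X\<^sub>1) \<inter> (G \<union> X\<^sub>2) - K)) \<le> r (F \<union> X\<^sub>1) + r (G \<union> X\<^sub>2)"
proof (rule bexI[of _ E], rule bexI[of _ "{}"], intro conjI ballI impI)
  interpret swap: free_amalgam M\<^sub>2 M\<^sub>1 S\<^sub>2 S\<^sub>1 S\<^sub>2' S\<^sub>1' T\<^sub>2 T\<^sub>1 E k \<Z> r by (rule swap)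
  have FS: "F \<subseteq> S\<^sub>1" and GS: "G \<subseteq> S\<^sub>2" using flat1(3)[OF F] swap.flat1(3)[OF G] by auto
  show "(F \<union> X\<^sub>1) \<union> (G \<union> X\<^sub>2) \<subseteq> E" using lift1_subset_E[OF FS] swap.lift1_subset_E[OF GS] by blast
  show "E \<subseteq> W" if W: "W \<in> \<Z>" "(F \<union> X\<^sub>1) \<union> (G \<union> X\<^sub>2) \<subseteq> W" for W
    using W(1)
  proof (cases rule: Z_cases)
    case 1
    then show ?thesis using W(2) flat1(2)[OF F] by blast
  next
    case (3 H)
    then show ?thesis using swap.lift1_not_subset_lift2[OF G 3(1)] W(2) by blast
  next
    case (4 H)
    then show ?thesis using lift1_not_subset_lift2[OF F 4(1)] W(2) by blast
  qed simp
  show "W \<subseteq> {}" if W: "W \<in> \<Z>" "W \<subseteq> (F \<union> X\<^sub>1) \<inter> (G \<union> X\<^sub>2)" for W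
    using W(1)
  proof (cases rule: Z_cases)
    case 2
    then show ?thesis using E_not_subset_lift1[OF F] W(2) by blast
  next
    case (3 H)
    then show ?thesis using lift1_not_subset_lift2[OF 3(1) G] W(2) by blast
  next
    case (4 H)
    then show ?thesis using swap.lift1_not_subset_lift2[OF 4(1) F] W(2) by blast
  qed simp
  \<comment> \<open>\<open>X\<^sub>1\<close> and \<open>X\<^sub>2\<close> are disjoint, as are
    \<open>F\<close> and \<open>G\<close>, so only the mixed intersections survive.\<close>
  have "(F \<union> X\<^sub>1) \<inter> (G \<union> X\<^sub>2) \<subseteq> (F \<inter> S\<^sub>1') \<union> (G \<inter> S\<^sub>2')"
    using FS GS disjoint_T disjoint_S sub1 sub2 by auto
  then have "card ((F \<union> X\<^sub>1) \<inter> (G \<union> X\<^sub>2)) \<le> card ((F \<inter> S\<^sub>1') \<union> (G \<inter> S\<^sub>2'))"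
    using finite_sub by (intro card_mono) auto
  also have "\<dots> \<le> card (F \<inter> S\<^sub>1') + card (G \<inter> S\<^sub>2')" by (rule card_Un_le)
  finally have "int (card ((F \<union> X\<^sub>1) \<inter> (G \<union> X\<^sub>2)))
      \<le> int (rank M\<^sub>1 F) + nullity M\<^sub>1 S\<^sub>1' + (int (rank M\<^sub>2 G) + nullity M\<^sub>2 S\<^sub>2')"
    using card_Int_S1'[of F] swap.card_Int_S1'[of G] by linarith
  \<comment> \<open>The two ranks sum to r_1(F) + r_2(G) + 2k - r(M_1) - r(M_2). After subtracting
    \<open>k\<close>, the lower bound on \<open>k\<close> leaves exactly room for the two
    nullities.\<close>
  then show "r E + r {} + int (card ((F \<union> X\<^sub>1) \<inter> (G \<union> X\<^sub>2) - {})) \<le> r (F \<union> X\<^sub>1) + r (G \<union> X\<^sub>2)"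
    using r_lift1[OF F] swap.r_lift1[OF G] card_X1 swap.card_X1 k_ge r_E r_empty by simp
qed (use in_Z in simp_all)

lemma lift1_gap:
  assumes "F \<in> proper_cyclic_flats M\<^sub>1" "G \<in> proper_cyclic_flats M\<^sub>1" "F \<union> X\<^sub>1 \<subset> G \<union> X\<^sub>1"
  shows "0 < r (G \<union> X\<^sub>1) - r (F \<union> X\<^sub>1)" "r (G \<union> X\<^sub>1) - r (F \<union> X\<^sub>1) < int (card ((G \<union> X\<^sub>1) - (F \<union> X\<^sub>1)))"
proof -
  have FG: "F \<subset> G" using assms(3) lift1_subset_iff[of F G] flat1(3)[OF assms(1)] by blast
  have GS: "G \<subseteq> S\<^sub>1" using flat1(3)[OF assms(2)] by blast
  then have fin: "finite G" using finite_S finite_subset by blast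
  have fl: "flat M\<^sub>1 F" and cyc: "cyclic M\<^sub>1 G"
    using flat1(1) assms by (auto simp: cyclic_flats_def)
  have "rank M\<^sub>1 F < rank M\<^sub>1 G" using M\<^sub>1.flat_rank_less[OF fl FG] GS ground_M1 by simp
  then show "0 < r (G \<union> X\<^sub>1) - r (F \<union> X\<^sub>1)" using r_lift1 assms by simp
  obtain x where x: "x \<in> G" "x \<notin> F" using FG by blast
  have "rank M\<^sub>1 G = rank M\<^sub>1 (G - {x})" using cyc x(1) M\<^sub>1.cyclic_iff_rank by simp
  also have "\<dots> \<le> rank M\<^sub>1 F + card (G - {x} - F)" using fin by (intro M\<^sub>1.rank_le_diff) simp
  also have "card (G - {x} - F) < card (G - F)" using fin x by (intro psubset_card_mono) auto
  finally have "rank M\<^sub>1 G < rank M\<^sub>1 F + card (G - F)" by simp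
  moreover have "(G \<union> X\<^sub>1) - (F \<union> X\<^sub>1) = G - F" using GS X1_disjoint by blast
  ultimately show "r (G \<union> X\<^sub>1) - r (F \<union> X\<^sub>1) < int (card ((G \<union> X\<^sub>1) - (F \<union> X\<^sub>1)))"
    using r_lift1 assms by simp
qed

lemma Z_subset_Pow: "\<Z> \<subseteq> Pow E"
proof
  interpret swap: free_amalgam M\<^sub>2 M\<^sub>1 S\<^sub>2 S\<^sub>1 S\<^sub>2' S\<^sub>1' T\<^sub>2 T\<^sub>1 E k \<Z> r by (rule swap)
  fix X assume "X \<in> \<Z>"
  then show "X \<in> Pow E"
  proof (cases rule: Z_cases)
    case (3 F)
    then show ?thesis using lift1_subset_E flat1(3) by blast
  next
    case (4 G)
    then show ?thesis using swap.lift1_subset_E swap.flat1(3) by blast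
  qed auto
qed

lemma cyclic_flat_axioms: "cyclic_flat_axioms \<Z> r"
proof (rule cyclic_flat_axiomsI[of "{}"])
  interpret swap: free_amalgam M\<^sub>2 M\<^sub>1 S\<^sub>2 S\<^sub>1 S\<^sub>2' S\<^sub>1' T\<^sub>2 T\<^sub>1 E k \<Z> r by (rule swap)
  show "{} \<in> \<Z>" "r {} = 0" using in_Z r_empty by auto
  have sub_E: "X \<subseteq> E" if "X \<in> \<Z>" for X using that Z_subset_Pow by blast
  fix X Y assume XY: "X \<in> \<Z>" "Y \<in> \<Z>"
  show "0 < r Y - r X \<and> r Y - r X < int (card (Y - X))" if sub: "X \<subset> Y"
    using XY(1)
  proof (cases rule: Z_cases)
    case 1
    show ?thesis using XY(2)
    proof (cases rule: Z_cases)
      case 2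
      then show ?thesis using 1 gap_bottom_top r_E r_empty by simp
    next
      case (3 F)
      then show ?thesis using 1 lift1_gap_bottom[OF 3(1)] r_empty by simp
    next
      case (4 G)
      then show ?thesis using 1 swap.lift1_gap_bottom[OF 4(1)] r_empty by simp
    qed (use 1 sub in simp)
  next
    case 2
    then show ?thesis using sub sub_E[OF XY(2)] by blast
  next
    case F: (3 F)
    show ?thesis using XY(2)
    proof (cases rule: Z_cases)
      case 1
      then show ?thesis using sub by blast
    next
      case 2
      then show ?thesis using F(2) lift1_gap_top[OF F(1)] by simp
    next
      case (3 G)
      then show ?thesis using F(2) lift1_gap[OF F(1) 3(1)] sub by simp
    next
      case (4 G)
      then show ?thesis using F(2) lift1_not_subset_lift2[OF F(1) 4(1)] sub by blast
    qed
  next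
    case F: (4 F)
    show ?thesis using XY(2)
    proof (cases rule: Z_cases)
      case 1
      then show ?thesis using sub by blast
    next
      case 2
      then show ?thesis using F(2) swap.lift1_gap_top[OF F(1)] by simp
    next
      case (3 G)
      then show ?thesis using F(2) swap.lift1_not_subset_lift2[OF F(1) 3(1)] sub by blast
    next
      case (4 G)
      then show ?thesis using F(2) swap.lift1_gap[OF F(1) 4(1)] sub by simp
    qed
  qed
  assume inc: "\<not> X \<subseteq> Y" "\<not> Y \<subseteq> X"
  have ne: "X \<noteq> {}" "X \<noteq> E" "Y \<noteq> {}" "Y \<noteq> E" using inc sub_E XY by auto
  show "\<exists>J \<in> \<Z>. \<exists>K \<in> \<Z>. X \<union> Y \<subseteq> J \<and> (\<forall>W \<in> \<Z>. X \<union> Y \<subseteq> W \<longrightarrow> J \<subseteq> W) \<and>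
      K \<subseteq> X \<inter> Y \<and> (\<forall>W \<in> \<Z>. W \<subseteq> X \<inter> Y \<longrightarrow> W \<subseteq> K) \<and>
      r J + r K + int (card (X \<inter> Y - K)) \<le> r X + r Y"
    using XY(1)
  proof (cases rule: Z_cases)
    case F: (3 F)
    show ?thesis using XY(2)
    proof (cases rule: Z_cases)
      case (3 G)
      then show ?thesis using lift1_join_meet[OF F(1) 3(1)] F(2) by simp
    next
      case (4 G)
      then show ?thesis using cross_join_meet[OF F(1) 4(1)] F(2) by simp
    qed (use ne in simp_all)
  next
    case F: (4 F)
    show ?thesis using XY(2)
    proof (cases rule: Z_cases)
      case (3 G)
      then show ?thesis using swap.cross_join_meet[OF F(1) 3(1)] F(2) by simp
    next
      case (4 G)
      then show ?thesis using swap.lift1_join_meet[OF F(1) 4(1)] F(2) by simp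
    qed (use ne in simp_all)
  qed (use ne in simp_all)
qed simp

lemma finite_E: "finite E"
  using E_eq finite_S finite_T1 finite_T2 by simp

section \<open>The restrictions of the amalgam\<close>

text \<open>Such an \<open>I\<close> meets the lift of \<open>G\<close> only in
  \<open>G \<inter> S\<^sub>2'\<close> and \<open>S\<^sub>1'\<close>. These have at most r_2(G) +
  \<eta>_2(S'_2) and r(M_1) + \<eta>_1(S'_1) elements, and |X_2| = k - r(M_2) absorbs all but
  r_2(G).\<close>

lemma card_Int_lift2:
  assumes I: "I \<subseteq> S\<^sub>1 \<union> X\<^sub>1" and G: "G \<subseteq> S\<^sub>2"
  shows "int (card (I \<inter> (G \<union> X\<^sub>2))) \<le> int (rank M\<^sub>2 G) + int (card X\<^sub>2)"
proof -
  interpret swap: free_amalgam M\<^sub>2 M\<^sub>1 S\<^sub>2 S\<^sub>1 S\<^sub>2' S\<^sub>1' T\<^sub>2 T\<^sub>1 E k \<Z> r by (rule swap)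
  have "I \<inter> (G \<union> X\<^sub>2) \<subseteq> (G \<inter> S\<^sub>2') \<union> S\<^sub>1'" using I G disjoint_T disjoint_S sub1 sub2 by blast
  then have "card (I \<inter> (G \<union> X\<^sub>2)) \<le> card ((G \<inter> S\<^sub>2') \<union> S\<^sub>1')"
    using finite_sub by (intro card_mono) auto
  also have "\<dots> \<le> card (G \<inter> S\<^sub>2') + card S\<^sub>1'" by (rule card_Un_le)
  finally show ?thesis
    using swap.card_Int_S1'[of G] card_S1'_le swap.card_X1 k_ge by linarith
qed

context
  fixes M :: "'a indep_system"
  assumes M: "matroid M" "ground M = E" "cyclic_flats M = \<Z>" "\<forall>Y \<in> \<Z>. int (rank M Y) = r Y"
begin

lemma indep_iff_Z: "I \<in> indep M \<longleftrightarrow> I \<subseteq> E \<and> (\<forall>W \<in> \<Z>. int (card (I \<inter> W)) \<le> r W)"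
proof -
  have "card (I \<inter> W) \<le> rank M W \<longleftrightarrow> int (card (I \<inter> W)) \<le> r W" if "W \<in> \<Z>" for W
    using M(4) that of_nat_le_iff[of "card (I \<inter> W)" "rank M W", where 'a = int] by auto
  then show ?thesis using matroid.indep_iff_cyclic_flats[OF M(1), of I] M(2,3) by auto
qed

text \<open>Cancelling |I \<inter> X_1| turns the constraint of the lift of \<open>F\<close> into |I
  \<inter> F| - r_1(F) \<le> |X_1 - I|, and the constraint of \<open>E\<close> is the same with
  \<open>F = S\<^sub>1\<close>. The nullity of I \<inter> S_1 is the largest of these left-hand
  sides, attained at a cyclic flat of M_1.\<close>

lemma indep_lift1_iff:
  assumes I: "I \<subseteq> S\<^sub>1 \<union> X\<^sub>1"
  shows "I \<in> indep M \<longleftrightarrow> nullity M\<^sub>1 (I \<inter> S\<^sub>1) \<le> int (card (X\<^sub>1 - I))"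
proof -
  have IE: "I \<subseteq> E" using I lift1_subset_E[of S\<^sub>1] by blast
  have part: "card (I \<inter> (F \<union> X\<^sub>1)) = card (I \<inter> F) + card (I \<inter> X\<^sub>1)" if "F \<subseteq> S\<^sub>1" for F
    unfolding Int_Un_distrib using that by (intro card_Un_X1) auto
  have X: "card X\<^sub>1 = card (I \<inter> X\<^sub>1) + card (X\<^sub>1 - I)"
    using finite_X1 by (metis Int_commute card_Int_Diff)
  have IS: "I \<inter> S\<^sub>1 \<subseteq> ground M\<^sub>1" using ground_M1 by simp
  have bound: "int (card (I \<inter> F)) - int (rank M\<^sub>1 F) \<le> nullity M\<^sub>1 (I \<inter> S\<^sub>1)" if "F \<subseteq> S\<^sub>1" for F
    using M\<^sub>1.nullity_le_card_Int[OF IS, of F] that by (simp add: Int_assoc Int_absorb1)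
  have cI: "card I = card (I \<inter> S\<^sub>1) + card (I \<inter> X\<^sub>1)"
    using part[of S\<^sub>1] I by (simp add: Int_absorb2)
  show ?thesis
  proof
    assume "I \<in> indep M"
    then have le: "int (card (I \<inter> W)) \<le> r W" if "W \<in> \<Z>" for W using that indep_iff_Z by blast
    obtain W where W: "W \<in> cyclic_flats M\<^sub>1" "rank M\<^sub>1 (I \<inter> S\<^sub>1) = rank M\<^sub>1 W + card (I \<inter> S\<^sub>1 - W)"
      using M\<^sub>1.rank_via_cyclic_flat[OF IS] by blast
    have WS: "W \<subseteq> S\<^sub>1" using W(1) ground_M1 by (auto simp: cyclic_flats_def flat_def)
    have "card (I \<inter> S\<^sub>1) = card (I \<inter> S\<^sub>1 \<inter> W) + card (I \<inter> S\<^sub>1 - W)"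
      using finite_S by (metis card_Int_Diff finite_Int)
    moreover have "I \<inter> S\<^sub>1 \<inter> W = I \<inter> W" using WS by blast
    ultimately have n: "nullity M\<^sub>1 (I \<inter> S\<^sub>1) = int (card (I \<inter> W)) - int (rank M\<^sub>1 W)"
      using W(2) unfolding nullity_def by simp
    consider "W = {}" | "W = S\<^sub>1" | "W \<in> proper_cyclic_flats M\<^sub>1"
      using W(1) ground_M1 by (auto simp: proper_cyclic_flats_def)
    then show "nullity M\<^sub>1 (I \<inter> S\<^sub>1) \<le> int (card (X\<^sub>1 - I))"
    proof cases
      case 1
      then show ?thesis using n by simp
    next
      case 2
      have "int (card I) \<le> k" using le[of E] in_Z r_E IE by (simp add: Int_absorb2)
      then show ?thesis using 2 n cI X card_X1 by simp
    next
      case 3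
      then show ?thesis using n le[OF in_Z(3)[OF 3]] r_lift1[OF 3] part[OF WS] X by simp
    qed
  next
    assume n: "nullity M\<^sub>1 (I \<inter> S\<^sub>1) \<le> int (card (X\<^sub>1 - I))"
    have "int (card (I \<inter> W)) \<le> r W" if "W \<in> \<Z>" for W
      using that
    proof (cases rule: Z_cases)
      case 1
      then show ?thesis using r_empty by simp
    next
      case 2
      \<comment> \<open>\<open>S\<^sub>1\<close> need not be a cyclic flat of M_1, but
        \<open>bound\<close> holds for every subset of \<open>S\<^sub>1\<close>.\<close>
      have "int (card I) \<le> k" using bound[of S\<^sub>1] n cI X card_X1 by simp
      then show ?thesis using 2 r_E IE by (simp add: Int_absorb2)
    next
      case (3 F)
      have FS: "F \<subseteq> S\<^sub>1" using flat1(3)[OF 3(1)] by blast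
      then show ?thesis using bound[OF FS] n r_lift1[OF 3(1)] part[OF FS] X 3(2) by simp
    next
      case (4 G)
      have "G \<subseteq> S\<^sub>2" using free_amalgam.flat1(3)[OF swap 4(1)] by blast
      then show ?thesis
        using card_Int_lift2[OF I] free_amalgam.r_lift1[OF swap 4(1)] 4(2) by simp
    qed
    then show "I \<in> indep M" using indep_iff_Z IE by blast
  qed
qed

lemma restriction_eq_free_coextension: "restriction M (S\<^sub>1 \<union> X\<^sub>1) = free_coextension M\<^sub>1 X\<^sub>1"
proof -
  have "free_coextension M\<^sub>1 X\<^sub>1 = \<lparr>ground = S\<^sub>1 \<union> X\<^sub>1,
      indep = {I. I \<subseteq> S\<^sub>1 \<union> X\<^sub>1 \<and> nullity M\<^sub>1 (I \<inter> S\<^sub>1) \<le> int (card (X\<^sub>1 - I))}\<rparr>"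
    using M\<^sub>1.free_coextension_eq[OF finite_X1] X1_disjoint(1) ground_M1 by simp
  moreover have "{I \<in> indep M. I \<subseteq> S\<^sub>1 \<union> X\<^sub>1}
      = {I. I \<subseteq> S\<^sub>1 \<union> X\<^sub>1 \<and> nullity M\<^sub>1 (I \<inter> S\<^sub>1) \<le> int (card (X\<^sub>1 - I))}"
    using indep_lift1_iff by blast
  ultimately show ?thesis by (simp add: restriction_def)
qed

lemma nullity_lift1:
  assumes F: "F \<in> proper_cyclic_flats M\<^sub>1"
  shows "nullity M\<^sub>1 F = nullity M (F \<union> X\<^sub>1)"
proof -
  have "card (F \<union> X\<^sub>1) = card F + card X\<^sub>1" using flat1(3)[OF F] by (intro card_Un_X1) auto
  moreover have "int (rank M (F \<union> X\<^sub>1)) = int (rank M\<^sub>1 F) + int (card X\<^sub>1)"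
    using M(4) in_Z(3)[OF F] r_lift1[OF F] by simp
  ultimately show ?thesis by (simp add: nullity_def)
qed

end

end

section \<open>The amalgam\<close>

theorem theorem3p1:
  fixes M\<^sub>1 M\<^sub>2 :: "'a indep_system" and S\<^sub>1 S\<^sub>2 S\<^sub>1' S\<^sub>2' T\<^sub>1 T\<^sub>2 E :: "'a set"
    and k :: int and \<Z> :: "'a set set" and r :: "'a set \<Rightarrow> int"
  assumes "matroid M\<^sub>1" and "matroid M\<^sub>2"
    and "ground M\<^sub>1 = S\<^sub>1" and "ground M\<^sub>2 = S\<^sub>2" and "S\<^sub>1 \<inter> S\<^sub>2 = {}"
    and "0 < rank M\<^sub>1 S\<^sub>1" and "0 < rank M\<^sub>2 S\<^sub>2"
    and "S\<^sub>1' \<subseteq> S\<^sub>1" and "S\<^sub>2' \<subseteq> S\<^sub>2"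
    and "k \<ge> int (rank M\<^sub>1 S\<^sub>1) + nullity M\<^sub>1 S\<^sub>1' + int (rank M\<^sub>2 S\<^sub>2) + nullity M\<^sub>2 S\<^sub>2'"
    and "finite T\<^sub>1" and "finite T\<^sub>2"
    and "int (card T\<^sub>1) = k - int (rank M\<^sub>1 S\<^sub>1) - int (card S\<^sub>2')"
    and "int (card T\<^sub>2) = k - int (rank M\<^sub>2 S\<^sub>2) - int (card S\<^sub>1')"
    and "T\<^sub>1 \<inter> T\<^sub>2 = {}" and "T\<^sub>1 \<inter> (S\<^sub>1 \<union> S\<^sub>2) = {}" and "T\<^sub>2 \<inter> (S\<^sub>1 \<union> S\<^sub>2) = {}"
    and "E = S\<^sub>1 \<union> S\<^sub>2 \<union> T\<^sub>1 \<union> T\<^sub>2"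
    and "\<Z> = {{}, E} \<union> {F \<union> T\<^sub>1 \<union> S\<^sub>2' | F. F \<in> proper_cyclic_flats M\<^sub>1}
                   \<union> {F \<union> T\<^sub>2 \<union> S\<^sub>1' | F. F \<in> proper_cyclic_flats M\<^sub>2}"
    and "r {} = 0" and "r E = k"
    and "\<And>F. F \<in> proper_cyclic_flats M\<^sub>1 \<Longrightarrow>
           r (F \<union> T\<^sub>1 \<union> S\<^sub>2') = int (rank M\<^sub>1 F) + int (card T\<^sub>1) + int (card S\<^sub>2')"
    and "\<And>F. F \<in> proper_cyclic_flats M\<^sub>2 \<Longrightarrow>
           r (F \<union> T\<^sub>2 \<union> S\<^sub>1') = int (rank M\<^sub>2 F) + int (card T\<^sub>2) + int (card S\<^sub>1')"
    \<comment> \<open>Without the following two conditions \<open>E\<close> cannot be a cyclic flat: if \<open>T\<^sub>2 = {}\<close> and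
        \<open>S\<^sub>2' = S\<^sub>2\<close> then \<open>S\<^sub>1 \<union> T\<^sub>1 \<union> S\<^sub>2' = E\<close>, so (i) makes each coloop of \<open>M\<^sub>1\<close> a coloop of \<open>M\<close>.\<close>
    and "T\<^sub>2 = {} \<Longrightarrow> S\<^sub>2' = S\<^sub>2 \<Longrightarrow> \<not> (\<exists>e. coloop M\<^sub>1 e)"
    and "T\<^sub>1 = {} \<Longrightarrow> S\<^sub>1' = S\<^sub>1 \<Longrightarrow> \<not> (\<exists>e. coloop M\<^sub>2 e)"
  shows "cyclic_flat_axioms \<Z> r
    \<and> (\<exists>M. matroid M \<and> ground M = E \<and> cyclic_flats M = \<Z>
           \<and> (\<forall>Y \<in> \<Z>. int (rank M Y) = r Y))
    \<and> (\<forall>M. matroid M \<and> ground M = E \<and> cyclic_flats M = \<Z>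
           \<and> (\<forall>Y \<in> \<Z>. int (rank M Y) = r Y) \<longrightarrow>
         int (rank M (ground M)) = k
         \<and> restriction M (S\<^sub>1 \<union> T\<^sub>1 \<union> S\<^sub>2') = free_coextension M\<^sub>1 (T\<^sub>1 \<union> S\<^sub>2')
         \<and> restriction M (S\<^sub>2 \<union> T\<^sub>2 \<union> S\<^sub>1') = free_coextension M\<^sub>2 (T\<^sub>2 \<union> S\<^sub>1')
         \<and> amalgam M (free_coextension M\<^sub>1 (T\<^sub>1 \<union> S\<^sub>2')) (free_coextension M\<^sub>2 (T\<^sub>2 \<union> S\<^sub>1'))
         \<and> (\<forall>F \<in> proper_cyclic_flats M\<^sub>1. nullity M\<^sub>1 F = nullity M (F \<union> T\<^sub>1 \<union> S\<^sub>2'))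
         \<and> (\<forall>F \<in> proper_cyclic_flats M\<^sub>2. nullity M\<^sub>2 F = nullity M (F \<union> T\<^sub>2 \<union> S\<^sub>1')))"
proof -
  interpret A: free_amalgam M\<^sub>1 M\<^sub>2 S\<^sub>1 S\<^sub>2 S\<^sub>1' S\<^sub>2' T\<^sub>1 T\<^sub>2 E k \<Z> r
    by (rule free_amalgam.intro) (fact assms)+
  interpret B: free_amalgam M\<^sub>2 M\<^sub>1 S\<^sub>2 S\<^sub>1 S\<^sub>2' S\<^sub>1' T\<^sub>2 T\<^sub>1 E k \<Z> r by (rule A.swap)
  interpret cyclic_flat_system E \<Z> r
    by unfold_locales (fact A.finite_E A.Z_subset_Pow A.cyclic_flat_axioms)+
  have ground: "ground (free_coextension M\<^sub>1 (T\<^sub>1 \<union> S\<^sub>2')) = S\<^sub>1 \<union> (T\<^sub>1 \<union> S\<^sub>2')"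
    "ground (free_coextension M\<^sub>2 (T\<^sub>2 \<union> S\<^sub>1')) = S\<^sub>2 \<union> (T\<^sub>2 \<union> S\<^sub>1')"
    using A.M\<^sub>1.free_coextension_eq[OF A.finite_X1] A.X1_disjoint(1) A.ground_M1
      A.M\<^sub>2.free_coextension_eq[OF B.finite_X1] B.X1_disjoint(1) B.ground_M1 by simp_all
  have union: "E = S\<^sub>1 \<union> (T\<^sub>1 \<union> S\<^sub>2') \<union> (S\<^sub>2 \<union> (T\<^sub>2 \<union> S\<^sub>1'))" using A.E_eq A.sub1 A.sub2 by blast
  \<comment> \<open>Independence in any such \<open>M\<close> is fixed by the cyclic flats and their
    ranks, so the claims cover every matroid with this data and not just the constructed
    one.\<close>
  have "int (rank M (ground M)) = k
      \<and> restriction M (S\<^sub>1 \<union> T\<^sub>1 \<union> S\<^sub>2') = free_coextension M\<^sub>1 (T\<^sub>1 \<union> S\<^sub>2')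
      \<and> restriction M (S\<^sub>2 \<union> T\<^sub>2 \<union> S\<^sub>1') = free_coextension M\<^sub>2 (T\<^sub>2 \<union> S\<^sub>1')
      \<and> amalgam M (free_coextension M\<^sub>1 (T\<^sub>1 \<union> S\<^sub>2')) (free_coextension M\<^sub>2 (T\<^sub>2 \<union> S\<^sub>1'))
      \<and> (\<forall>F \<in> proper_cyclic_flats M\<^sub>1. nullity M\<^sub>1 F = nullity M (F \<union> T\<^sub>1 \<union> S\<^sub>2'))
      \<and> (\<forall>F \<in> proper_cyclic_flats M\<^sub>2. nullity M\<^sub>2 F = nullity M (F \<union> T\<^sub>2 \<union> S\<^sub>1'))"
    if M: "matroid M" "ground M = E" "cyclic_flats M = \<Z>" "\<forall>Y \<in> \<Z>. int (rank M Y) = r Y" for M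
  proof -
    have "int (rank M (ground M)) = k" using M(2,4) A.in_Z(2) A.r_E by simp
    moreover have "amalgam M (free_coextension M\<^sub>1 (T\<^sub>1 \<union> S\<^sub>2')) (free_coextension M\<^sub>2 (T\<^sub>2 \<union> S\<^sub>1'))"
      unfolding amalgam_def ground
      using A.restriction_eq_free_coextension[OF M] B.restriction_eq_free_coextension[OF M]
        M(1,2) union by blast
    ultimately show ?thesis
      using A.restriction_eq_free_coextension[OF M] B.restriction_eq_free_coextension[OF M]
        A.nullity_lift1[OF M] B.nullity_lift1[OF M]
      by (simp add: Un_assoc)
  qed
  then show ?thesis using A.cyclic_flat_axioms ex_matroid by blast
qed

end
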